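(* Let $Y$ be a scalar random variable and $X\in\mathbb{R}^p$ a random vector with first component $1$ and support $\mathcal{X}$. For $t\in(0,1)$ let $\beta(t)\in\arg\min_{\beta\in\mathbb{R}^p}\mathrm{E}\,\rho_t(Y-X^\top\beta)$, where $\rho_t(z)=t\max(z,0)+(1-t)\max(-z,0)$ (equivalently $\beta(t)$ minimizes $\mathrm{E}(Y-X^\top\beta)_++(1-t)\mathrm{E}X^\top\beta$), and let $A_t=1(Y>X^\top\beta(t))$. Assume (QR): $\mathrm{E}|Y|<\infty$, $\mathrm{E}\|X\|^2<\infty$, the conditional density $(y,x)\mapsto f_{Y\mid X}(y,x)$ exists and is bounded and uniformly continuous, and $\mathrm{E}(f_{Y\mid X}(X^\top\beta(t),X)XX^\top)$ has full rank for each $t\in(0,1)$. Then: (i) If $t\mapsto x^\top\beta(t)$ is increasing on $(0,1)$ for each $x\in\mathcal{X}$, then $\widetilde U:=\int_0^1A_t\,dt$ satisfies $Y=X^\top\beta(\widetilde U)$ a.s., $\widetilde U\sim U(0,1)$ and $\mathrm{E}(X\mid\widetilde U)=\mathrm{E}(X)$; moreover $\widetilde U$ solves $\max\{\mathrm{E}(VY): V\sim U(0,1),\ \mathrm{E}(X\mid V)=\mathrm{E}(X)\}$. (ii) Under the monotonicity assumption of (i), the representation is unique a.s.: if also $Y=\overline\beta(\overline U)^\top X$ with $\overline U\sim U(0,1)$, $\mathrm{E}(X\mid\overline U)=\mathrm{E}(X)$, and $u\mapsto X^\top\overline\beta(u)$ increasing in $u\in(0,1)$ a.s., then $\widetilde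 U=\overline U$ and $X^\top\beta(\widetilde U)=X^\top\overline\beta(\overline U)$ a.s. (iii) If the conditional quantile function of $Y$ given $X$ is linear, $Q_{Y\mid X}(u)=X^\top\beta_0(u)$, so that $Y=X^\top\beta_0(U)$ with $U\sim U(0,1)$ independent of $X$, then $U=\widetilde U$ and $\beta_0(U)=\beta(U)$ a.s.
   Context: $U(0,1)$ denotes the uniform distribution on $(0,1)$; $z_+=\max(z,0)$. *)

theory Defs
  imports "HOL-Probability.Probability"
begin

definition rho :: "real \<Rightarrow> real \<Rightarrow> real" where
  "rho t z = t * max z 0 + (1 - t) * max (- z) 0"

definition is_qr_coef :: "'a measure \<Rightarrow> ('a \<Rightarrow> real) \<Rightarrow> ('a \<Rightarrow> real^'p) \<Rightarrow> real \<Rightarrow> real^'p \<Rightarrow> bool" where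
  "is_qr_coef M Y X t b \<longleftrightarrow>
     (\<forall>c. (\<integral>\<omega>. rho t (Y \<omega> - X \<omega> \<bullet> b) \<partial>M) \<le> (\<integral>\<omega>. rho t (Y \<omega> - X \<omega> \<bullet> c) \<partial>M))"

definition cond_density :: "'a measure \<Rightarrow> ('a \<Rightarrow> real) \<Rightarrow> ('a \<Rightarrow> real^'p) \<Rightarrow> (real \<Rightarrow> real^'p \<Rightarrow> real) \<Rightarrow> bool" where
  "cond_density M Y X f \<longleftrightarrow>
     (\<forall>y x. 0 \<le> f y x) \<and> case_prod f \<in> borel_measurable borel \<and>
     (\<forall>A\<in>sets borel. \<forall>B\<in>sets borel.
        emeasure M {\<omega>\<in>space M. Y \<omega> \<in> A \<and> X \<omega> \<in> B} =
        (\<integral>\<^sup>+\<omega>. indicator B (X \<omega>) * (\<integral>\<^sup>+y. indicator A y * ennreal (f y (X \<omega>)) \<partial>lborel) \<partial>M))"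

definition supp :: "'a measure \<Rightarrow> ('a \<Rightarrow> real^'p) \<Rightarrow> (real^'p) set" where
  "supp M X = {x. \<forall>e>0. 0 < measure M {\<omega>\<in>space M. X \<omega> \<in> ball x e}}"

definition unif01 :: "'a measure \<Rightarrow> ('a \<Rightarrow> real) \<Rightarrow> bool" where
  "unif01 M V \<longleftrightarrow> V \<in> borel_measurable M \<and> distr M lborel V = uniform_measure lborel {0<..<1}"

definition mean_indep :: "'a measure \<Rightarrow> ('a \<Rightarrow> real^'p) \<Rightarrow> ('a \<Rightarrow> real) \<Rightarrow> bool" where
  "mean_indep M X V \<longleftrightarrow>
     (\<forall>i. AE \<omega> in M. real_cond_exp M (vimage_algebra (space M) V borel) (\<lambda>\<omega>. X \<omega> $ i) \<omega>
                     = (\<integral>\<omega>'. X \<omega>' $ i \<partial>M))"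

definition jac_mat :: "'a measure \<Rightarrow> ('a \<Rightarrow> real^'p) \<Rightarrow> (real \<Rightarrow> real^'p \<Rightarrow> real) \<Rightarrow> real^'p \<Rightarrow> real^'p^'p" where
  "jac_mat M X f b = (\<chi> i j. \<integral>\<omega>. f (X \<omega> \<bullet> b) (X \<omega>) * X \<omega> $ i * X \<omega> $ j \<partial>M)"

definition cond_quantile :: "(real \<Rightarrow> real^'p \<Rightarrow> real) \<Rightarrow> real \<Rightarrow> real^'p \<Rightarrow> real" where
  "cond_quantile f u x = Inf {y. u \<le> (\<integral>s. indicator {..y} s * f s x \<partial>lborel)}"

definition Utilde :: "('a \<Rightarrow> real) \<Rightarrow> ('a \<Rightarrow> real^'p) \<Rightarrow> (real \<Rightarrow> real^'p) \<Rightarrow> 'a \<Rightarrow> real" where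
  "Utilde Y X \<beta> \<omega> = (LBINT t=0..1. (if Y \<omega> > X \<omega> \<bullet> \<beta> t then 1 else 0))"

definition indep_rv :: "'a measure \<Rightarrow> ('a \<Rightarrow> real) \<Rightarrow> ('a \<Rightarrow> real^'p) \<Rightarrow> bool" where
  "indep_rv M U X \<longleftrightarrow> U \<in> borel_measurable M \<and> X \<in> borel_measurable M \<and>
     (\<forall>A\<in>sets borel. \<forall>B\<in>sets borel.
        measure M {\<omega>\<in>space M. U \<omega> \<in> A \<and> X \<omega> \<in> B} =
        measure M {\<omega>\<in>space M. U \<omega> \<in> A} * measure M {\<omega>\<in>space M. X \<omega> \<in> B})"

end

theory Submission
  imports Defs
begin

text \<open>
  Up to an affine term the quantile regression loss is the convex function
  \<open>b \<mapsto> E (Y - X \<bullet> b)\<^sub>+ + (1 - t) E X \<bullet> b\<close>, and its Bregman remainder at \<open>b\<close> in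
  direction \<open>h\<close> is the mean of a nonnegative quantity that is positive exactly when \<open>Y\<close> separates
  \<open>X \<bullet> b\<close> from \<open>X \<bullet> (b + h)\<close>. Hence \<open>b\<close> is a minimizer iff
  \<open>E (1(Y > X \<bullet> b) X) = (1 - t) E X\<close>. If \<open>b + h\<close> is another minimizer, \<open>Y\<close> almost surely does not
  separate the two, so by continuity of the conditional density \<open>f (X \<bullet> b, X) (X \<bullet> h) = 0\<close> and the
  Jacobian kills \<open>h\<close>. So minimizers are unique, and therefore continuous in \<open>t\<close>.

  Under monotonicity the events \<open>Utilde > t\<close> and \<open>Y > X \<bullet> \<beta> t\<close> agree almost surely, so the
  first-order conditions say precisely that \<open>Utilde\<close> is uniform and \<open>X\<close> is mean independent of it,
  and continuity of \<open>\<beta>\<close> gives the representation of \<open>Y\<close>. Optimality is linear programming duality,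
  level by level in \<open>t\<close>. Conversely, for any monotone representation \<open>Y = X \<bullet> \<gamma> V\<close> the
  events \<open>V > t\<close> and \<open>Y > X \<bullet> \<gamma> t\<close> agree, so \<open>\<gamma> t\<close> satisfies the first-order condition and
  equals \<open>\<beta> t\<close>; a linear conditional quantile function is a special case.
\<close>

subsection \<open>Uniform variables, mean independence and supports\<close>

context prob_space
begin

lemma unif01_D:
  assumes "unif01 M V"
  shows unif01_measurable: "V \<in> borel_measurable M"
    and unif01_AE: "AE \<omega> in M. V \<omega> \<in> {0<..<1}"
    and unif01_tail: "t \<in> {0<..<1} \<Longrightarrow> prob {\<omega>\<in>space M. t < V \<omega>} = 1 - t"
proof -
  show V[measurable]: "V \<in> borel_measurable M" using assms by (simp add: unif01_def)
  have d: "distr M lborel V = uniform_measure lborel {0<..<1}" using assms by (simp add: unif01_def)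
  have "AE x in distr M lborel V. x \<in> {0<..<1}"
    unfolding d by (rule AE_uniform_measureI) auto
  then show "AE \<omega> in M. V \<omega> \<in> {0<..<1}"
    by (subst (asm) AE_distr_iff) auto
  assume t: "t \<in> {0<..<1}"
  have "prob {\<omega>\<in>space M. t < V \<omega>} = measure (distr M lborel V) {t<..}"
    by (subst measure_distr) (auto intro!: arg_cong[where f=prob])
  also have "\<dots> = measure lborel ({0<..<1} \<inter> {t<..})"
    unfolding d by (subst measure_uniform_measure) auto
  also have "{0<..<1} \<inter> {t<..} = {t<..<1}" using t by auto
  finally show "prob {\<omega>\<in>space M. t < V \<omega>} = 1 - t" using t by simp
qed

lemma unif01I:
  assumes [measurable]: "V \<in> borel_measurable M"
    and tail: "\<And>t. t \<in> {0<..<1} \<Longrightarrow> prob {\<omega>\<in>space M. t < V \<omega>} = 1 - t"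
  shows "unif01 M V"
proof -
  have le: "prob {\<omega>\<in>space M. V \<omega> \<le> t} = 1 - prob {\<omega>\<in>space M. t < V \<omega>}" for t
  proof -
    have "{\<omega>\<in>space M. V \<omega> \<le> t} = space M - {\<omega>\<in>space M. t < V \<omega>}" by auto
    then show ?thesis by (simp add: prob_compl)
  qed
  have mono: "prob {\<omega>\<in>space M. V \<omega> \<le> s} \<le> prob {\<omega>\<in>space M. V \<omega> \<le> t}" if "s \<le> t" for s t
    using that by (intro finite_measure_mono) auto
  have F: "prob {\<omega>\<in>space M. V \<omega> \<le> x} = max 0 (min 1 x)" for x
  proof (cases "x \<in> {0<..<1}")
    case True
    then show ?thesis using tail le by simp
  next
    case False
    show ?thesis
    proof (cases "x \<le> 0")
      case True
      \<comment> \<open>The tail is prescribed at interior levels only, so the values at and beyond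
        the endpoints come from monotonicity: this probability is at most every t in (0,1).\<close>
      have "prob {\<omega>\<in>space M. V \<omega> \<le> x} \<le> 0"
      proof (rule dense_ge_bounded[of 0 1])
        fix t :: real assume "0 < t" "t < 1"
        then show "prob {\<omega>\<in>space M. V \<omega> \<le> x} \<le> t"
          using mono[of x t] True tail[of t] le[of t] by simp
      qed simp
      then show ?thesis using True measure_nonneg[of M "{\<omega>\<in>space M. V \<omega> \<le> x}"] by simp
    next
      case x: False
      have "1 \<le> prob {\<omega>\<in>space M. V \<omega> \<le> x}"
      proof (rule dense_le_bounded[of 0 1])
        fix t :: real assume "0 < t" "t < 1"
        then show "t \<le> prob {\<omega>\<in>space M. V \<omega> \<le> x}"
          using mono[of t x] x False tail[of t] le[of t] by simp
      qed simp
      then show ?thesis using x False prob_le_1[of "{\<omega>\<in>space M. V \<omega> \<le> x}"] by simp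
    qed
  qed
  have "distr M borel V = uniform_measure lborel {0<..<1}"
  proof (rule cdf_unique)
    show "real_distribution (distr M borel V)" by (rule real_distribution_distr) simp
    have "prob_space (uniform_measure lborel {0<..<1::real})"
      by (rule prob_space_uniform_measure) auto
    then show "real_distribution (uniform_measure lborel {0<..<1})"
      by (simp add: real_distribution_def real_distribution_axioms_def)
    show "cdf (distr M borel V) = cdf (uniform_measure lborel {0<..<1})"
    proof
      fix x
      have "cdf (distr M borel V) x = prob {\<omega>\<in>space M. V \<omega> \<le> x}"
        unfolding cdf_def by (subst measure_distr) (auto intro!: arg_cong[where f=prob])
      moreover have "cdf (uniform_measure lborel {0<..<1}) x = measure lborel ({0<..<1} \<inter> {..x})"
        unfolding cdf_def by (subst measure_uniform_measure) auto
      moreover have "{0<..<1} \<inter> {..x} = (if x < 1 then {0<..x} else {0<..<1})" by auto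
      ultimately show "cdf (distr M borel V) x = cdf (uniform_measure lborel {0<..<1}) x"
        by (auto simp: F max_def min_def)
    qed
  qed
  \<comment> \<open>\<open>unif01\<close> uses \<open>lborel\<close> as target while
    \<open>cdf_unique\<close> was applied with \<open>borel\<close>; the two have the same sets, so
    the image measures agree.\<close>
  moreover have "distr M lborel V = distr M borel V" by (rule distr_cong) auto
  ultimately show ?thesis by (simp add: unif01_def)
qed

text \<open>The difference of the two events has probability zero. This turns a one-sided comparison
  of events into an almost sure equality once their probabilities are known.\<close>

lemma AE_iff_of_prob_eq:
  assumes [measurable]: "Measurable.pred M A" "Measurable.pred M B"
    and imp: "AE \<omega> in M. A \<omega> \<longrightarrow> B \<omega>"
    and eq: "prob {\<omega>\<in>space M. A \<omega>} = prob {\<omega>\<in>space M. B \<omega>}"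
  shows "AE \<omega> in M. A \<omega> \<longleftrightarrow> B \<omega>"
proof -
  have "prob {\<omega>\<in>space M. A \<omega>} = prob {\<omega>\<in>space M. A \<omega> \<and> B \<omega>}"
    using imp by (intro finite_measure_eq_AE) auto
  moreover have "prob {\<omega>\<in>space M. B \<omega>} = prob {\<omega>\<in>space M. A \<omega> \<and> B \<omega>} + prob {\<omega>\<in>space M. \<not> A \<omega> \<and> B \<omega>}"
    by (subst finite_measure_Union[symmetric]) (auto intro!: arg_cong[where f=prob])
  ultimately have "prob {\<omega>\<in>space M. \<not> A \<omega> \<and> B \<omega>} = 0" using eq by simp
  then have "AE \<omega> in M. \<not> (\<not> A \<omega> \<and> B \<omega>)"
    by (intro AE_I'[of "{\<omega>\<in>space M. \<not> A \<omega> \<and> B \<omega>}"]) (auto simp: null_sets_def emeasure_eq_measure)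
  with imp show ?thesis by eventually_elim auto
qed

section \<open>Mean independence expressed through tail events\<close>

lemma subalgebra_vimage:
  assumes "V \<in> borel_measurable M"
  shows "finite_measure_subalgebra M (vimage_algebra (space M) V borel)"
proof -
  have "sets (vimage_algebra (space M) V borel) \<subseteq> sets M"
    using assms by (auto simp: sets_vimage_algebra2 dest: measurable_sets)
  then show ?thesis
    by unfold_locales (simp add: subalgebra_def)
qed

text \<open>The event V > t lies in the sigma-algebra generated by V, so on it X may be replaced by
  its conditional expectation, which is constant. The tail identity has the shape of the first-order
  condition of quantile regression.\<close>

lemma mean_indep_tail:
  fixes X :: "'a \<Rightarrow> real^'p"
  assumes X: "integrable M X" and V: "unif01 M V" and mi: "mean_indep M X V" and t: "t \<in> {0<..<1}"
  shows "(\<integral>\<omega>. (if t < V \<omega> then X \<omega> else 0) \<partial>M) = (1 - t) *\<^sub>R (\<integral>\<omega>. X \<omega> \<partial>M)"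
proof (rule vec_eq_iff[THEN iffD2], rule allI)
  fix i
  note [measurable] = unif01_measurable[OF V]
  let ?F = "vimage_algebra (space M) V borel"
  interpret F: finite_measure_subalgebra M ?F by (rule subalgebra_vimage) simp
  have Xi: "integrable M (\<lambda>\<omega>. X \<omega> $ i)"
    using integrable_bounded_linear[OF bounded_linear_vec_nth X] .
  have Xt: "integrable M (\<lambda>\<omega>. if t < V \<omega> then X \<omega> else 0)"
    by (rule Bochner_Integration.integrable_bound[OF X]) (use X in auto)
  let ?A = "{\<omega>\<in>space M. t < V \<omega>}"
  have "?A = V -` {t<..} \<inter> space M" by auto
  then have A: "?A \<in> sets ?F" by (simp add: in_vimage_algebra)
  have AM: "?A \<in> sets M" by simp
  have "(\<integral>\<omega>. (if t < V \<omega> then X \<omega> else 0) \<partial>M) $ i = (\<integral>\<omega>. (if t < V \<omega> then X \<omega> else 0) $ i \<partial>M)"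
    using integral_bounded_linear[OF bounded_linear_vec_nth Xt] by simp
  also have "\<dots> = (\<integral>\<omega>\<in>?A. X \<omega> $ i \<partial>M)"
    unfolding set_lebesgue_integral_def by (intro Bochner_Integration.integral_cong) auto
  also have "\<dots> = (\<integral>\<omega>\<in>?A. real_cond_exp M ?F (\<lambda>\<omega>. X \<omega> $ i) \<omega> \<partial>M)"
    by (rule F.real_cond_exp_intA[OF Xi A])
  also have "\<dots> = (\<integral>\<omega>\<in>?A. (\<integral>\<omega>'. X \<omega>' $ i \<partial>M) \<partial>M)"
    using mi unfolding mean_indep_def
    by (intro set_lebesgue_integral_cong_AE) (auto elim!: allE[of _ i])
  also have "\<dots> = prob ?A * (\<integral>\<omega>'. X \<omega>' $ i \<partial>M)"
    by (simp add: set_lebesgue_integral_def)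
  also have "\<dots> = ((1 - t) *\<^sub>R (\<integral>\<omega>. X \<omega> \<partial>M)) $ i"
    using unif01_tail[OF V t] integral_bounded_linear[OF bounded_linear_vec_nth X] by simp
  finally show "(\<integral>\<omega>. (if t < V \<omega> then X \<omega> else 0) \<partial>M) $ i = ((1 - t) *\<^sub>R (\<integral>\<omega>. X \<omega> \<partial>M)) $ i" .
qed

text \<open>Converse of \<open>mean_indep_tail\<close>. The Borel sets B such that the centred
  coordinate \<open>g\<close> integrates to zero over the event V in B form a Dynkin system; the
  tail identity puts the open rays into it, and these are intersection stable and generate
  \<open>borel\<close>.\<close>

lemma mean_indepI:
  fixes X :: "'a \<Rightarrow> real^'p"
  assumes X: "integrable M X" and V: "unif01 M V"
    and tail: "\<And>t. t \<in> {0<..<1} \<Longrightarrow>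
      (\<integral>\<omega>. (if t < V \<omega> then X \<omega> else 0) \<partial>M) = (1 - t) *\<^sub>R (\<integral>\<omega>. X \<omega> \<partial>M)"
  shows "mean_indep M X V"
  unfolding mean_indep_def
proof
  fix i
  note [measurable] = unif01_measurable[OF V]
  let ?F = "vimage_algebra (space M) V borel"
  interpret F: finite_measure_subalgebra M ?F by (rule subalgebra_vimage) simp
  define m where "m = (\<integral>\<omega>. X \<omega> $ i \<partial>M)"
  define g where "g = (\<lambda>\<omega>. X \<omega> $ i - m)"
  have Xi: "integrable M (\<lambda>\<omega>. X \<omega> $ i)"
    using integrable_bounded_linear[OF bounded_linear_vec_nth X] .
  have g: "integrable M g" using Xi by (simp add: g_def)
  have g0: "(\<integral>\<omega>. g \<omega> \<partial>M) = 0" using Xi by (simp add: g_def m_def prob_space)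
  have gA: "set_integrable M A g" if "A \<in> sets M" for A
    using integrable_mult_indicator[OF that g] by (simp add: set_integrable_def)
  have gint: "(\<integral>\<omega>\<in>A. g \<omega> \<partial>M) = (\<integral>\<omega>\<in>A. X \<omega> $ i \<partial>M) - (\<integral>\<omega>\<in>A. m \<partial>M)" if "A \<in> sets M" for A
    unfolding g_def using integrable_mult_indicator[OF that Xi] integrable_mult_indicator[OF that integrable_const[of m]]
    by (intro set_integral_diff) (auto simp: set_integrable_def)
  have Ioi: "(\<integral>\<omega>\<in>V -` {t<..} \<inter> space M. g \<omega> \<partial>M) = 0" for t
  proof -
    \<comment> \<open>For a ray starting outside (0,1) the event is almost surely everything or
      nothing, and \<open>g\<close> has mean zero.\<close>
    consider "t \<le> 0" | "t \<in> {0<..<1}" | "1 \<le> t" by force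
    then show ?thesis
    proof cases
      case 1
      have "(\<integral>\<omega>\<in>V -` {t<..} \<inter> space M. g \<omega> \<partial>M) = (\<integral>\<omega>. g \<omega> \<partial>M)"
        unfolding set_lebesgue_integral_def
        using 1 AE_space unif01_AE[OF V] g by (intro integral_cong_AE) (auto elim!: eventually_elim2 simp: indicator_def intro: less_le_trans le_less_trans)
      then show ?thesis by (simp add: g0)
    next
      case 2
      have Xt: "integrable M (\<lambda>\<omega>. if t < V \<omega> then X \<omega> else 0)"
        by (rule Bochner_Integration.integrable_bound[OF X]) (use X in auto)
      have "(\<integral>\<omega>\<in>V -` {t<..} \<inter> space M. X \<omega> $ i \<partial>M) = (\<integral>\<omega>. (if t < V \<omega> then X \<omega> else 0) $ i \<partial>M)"
        unfolding set_lebesgue_integral_def by (intro Bochner_Integration.integral_cong) auto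
      also have "\<dots> = (\<integral>\<omega>. (if t < V \<omega> then X \<omega> else 0) \<partial>M) $ i"
        using integral_bounded_linear[OF bounded_linear_vec_nth Xt] by simp
      also have "\<dots> = (1 - t) * m"
        unfolding tail[OF 2] m_def using integral_bounded_linear[OF bounded_linear_vec_nth X] by simp
      also have "\<dots> = (\<integral>\<omega>\<in>V -` {t<..} \<inter> space M. m \<partial>M)"
      proof -
        have "V -` {t<..} \<inter> space M = {\<omega>\<in>space M. t < V \<omega>}" by auto
        then show ?thesis using unif01_tail[OF V 2] by (simp add: set_lebesgue_integral_def)
      qed
      finally show ?thesis by (subst gint) auto
    next
      case 3
      have "(\<integral>\<omega>\<in>V -` {t<..} \<inter> space M. g \<omega> \<partial>M) = (\<integral>\<omega>. 0 \<partial>M)"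
        unfolding set_lebesgue_integral_def
        using 3 AE_space unif01_AE[OF V] g by (intro integral_cong_AE) (auto elim!: eventually_elim2 simp: indicator_def intro: less_le_trans le_less_trans)
      then show ?thesis by simp
    qed
  qed
  have g_V: "(\<integral>\<omega>\<in>V -` B \<inter> space M. g \<omega> \<partial>M) = 0" if "B \<in> sets borel" for B
  proof -
    have sb: "sigma_sets UNIV (range (greaterThan :: real \<Rightarrow> _)) = sets borel" by (simp add: borel_Ioi)
    have "Int_stable (range (greaterThan :: real \<Rightarrow> _))"
    proof (rule Int_stableI_image)
      fix a b :: real
      have "{a<..} \<inter> {b<..} = {max a b<..}" by auto
      then show "\<exists>c\<in>UNIV. {a<..} \<inter> {b<..} = {c<..}" by blast
    qed
    moreover have "range (greaterThan :: real \<Rightarrow> _) \<subseteq> Pow UNIV" by simp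
    moreover have "B \<in> sigma_sets UNIV (range greaterThan)" using that by (simp add: sb)
    ultimately show ?thesis
    proof (induction rule: sigma_sets_induct_disjoint)
      case (basic A)
      then show ?case using Ioi by auto
    next
      case empty
      show ?case by (simp add: set_lebesgue_integral_def)
    next
      case (compl A)
      then have [measurable]: "A \<in> sets borel" by (simp add: sb)
      have "(\<integral>\<omega>\<in>V -` (UNIV - A) \<inter> space M. g \<omega> \<partial>M) =
          (\<integral>\<omega>. g \<omega> - indicator (V -` A \<inter> space M) \<omega> *\<^sub>R g \<omega> \<partial>M)"
        unfolding set_lebesgue_integral_def
        by (intro Bochner_Integration.integral_cong) (auto split: split_indicator)
      also have "\<dots> = 0"
        using compl.IH g gA[of "V -` A \<inter> space M"] g0
        by (subst Bochner_Integration.integral_diff) (auto simp: set_integrable_def set_lebesgue_integral_def)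
      finally show ?case .
    next
      case (union A)
      then have [measurable]: "A j \<in> sets borel" for j by (auto simp: sb)
      have "V -` (\<Union>j. A j) \<inter> space M = (\<Union>j. V -` A j \<inter> space M)" by auto
      moreover have "(\<integral>\<omega>\<in>(\<Union>j. V -` A j \<inter> space M). g \<omega> \<partial>M) = (\<Sum>j. (\<integral>\<omega>\<in>V -` A j \<inter> space M. g \<omega> \<partial>M))"
        using union(1) by (intro lebesgue_integral_countable_add gA) (auto simp: disjoint_family_on_def)
      ultimately show ?case using union.IH by simp
    qed
  qed
  have "AE \<omega> in M. real_cond_exp M ?F (\<lambda>\<omega>. X \<omega> $ i) \<omega> = m"
  proof (rule F.real_cond_exp_charact)
    fix A assume "A \<in> sets ?F"
    then obtain B where B[measurable]: "B \<in> sets borel" and A: "A = V -` B \<inter> space M"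
      by (auto simp: sets_vimage_algebra2)
    show "(\<integral>\<omega>\<in>A. X \<omega> $ i \<partial>M) = (\<integral>\<omega>\<in>A. m \<partial>M)"
      using g_V[OF B] gint[of A] by (simp add: A)
  qed (use Xi in auto)
  then show "AE \<omega> in M. real_cond_exp M ?F (\<lambda>\<omega>. X \<omega> $ i) \<omega> = (\<integral>\<omega>'. X \<omega>' $ i \<partial>M)"
    by (simp add: m_def)
qed

text \<open>Write V as the integral over t in (0,1) of the indicator of t < V and apply Fubini.
  Integrability in t is recorded too, because two such formulas are later compared level by
  level.\<close>

lemma layer_cake_unit_interval:
  fixes g :: "'a \<Rightarrow> real"
  assumes [measurable]: "V \<in> borel_measurable M" and V: "AE \<omega> in M. V \<omega> \<in> {0<..<1}"
    and g: "integrable M g"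
  shows "integrable lborel (\<lambda>t. indicator {0<..<1} t * (\<integral>\<omega>. (if t < V \<omega> then g \<omega> else 0) \<partial>M))"
    and "(\<integral>\<omega>. V \<omega> * g \<omega> \<partial>M) = (\<integral>t. indicator {0<..<1} t * (\<integral>\<omega>. (if t < V \<omega> then g \<omega> else 0) \<partial>M) \<partial>lborel)"
proof -
  interpret P: pair_sigma_finite M "lborel :: real measure" ..
  let ?h = "\<lambda>(\<omega>, t). indicator {0<..<1} t * (if t < V \<omega> then g \<omega> else 0)"
  have [measurable]: "g \<in> borel_measurable M" using g by simp
  \<comment> \<open>The constant c is left free so that the same rewriting serves for
    \<open>g \<omega>\<close> and for its absolute value.\<close>
  have eq: "AE \<omega> in M. \<forall>c. (\<lambda>t. indicator {0<..<1} t * (if t < V \<omega> then c else 0)) = (\<lambda>t. indicator {0<..<V \<omega>} t * (c::real))"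
    using V by eventually_elim (auto simp: fun_eq_iff split: split_indicator)
  have inth: "integrable (M \<Otimes>\<^sub>M lborel) ?h"
  proof (rule P.Fubini_integrable)
    have "AE \<omega> in M. V \<omega> * \<bar>g \<omega>\<bar> = (\<integral>t. norm (?h (\<omega>, t)) \<partial>lborel)"
      using V eq
    proof eventually_elim
      case (elim \<omega>)
      have "(\<integral>t. norm (?h (\<omega>, t)) \<partial>lborel) = (\<integral>t. indicator {0<..<1} t * (if t < V \<omega> then \<bar>g \<omega>\<bar> else 0) \<partial>lborel)"
        by (intro Bochner_Integration.integral_cong) (auto simp: abs_mult)
      also have "\<dots> = (\<integral>t. indicator {0<..<V \<omega>} t * \<bar>g \<omega>\<bar> \<partial>lborel)" using elim(2) by (simp only:)
      finally show ?case using elim by simp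
    qed
    moreover have "integrable M (\<lambda>\<omega>. V \<omega> * \<bar>g \<omega>\<bar>)"
    proof (rule Bochner_Integration.integrable_bound[OF g])
      show "AE \<omega> in M. norm (V \<omega> * \<bar>g \<omega>\<bar>) \<le> norm (g \<omega>)"
        using V by eventually_elim (auto simp: abs_mult mult_left_le_one_le)
    qed simp
    ultimately show "integrable M (\<lambda>\<omega>. \<integral>t. norm (?h (\<omega>, t)) \<partial>lborel)"
      by (subst integrable_cong_AE[symmetric]) auto
    show "AE \<omega> in M. integrable lborel (\<lambda>t. ?h (\<omega>, t))"
      using V eq by eventually_elim (simp only: case_prod_conv, simp)
  qed measurable
  show "integrable lborel (\<lambda>t. indicator {0<..<1} t * (\<integral>\<omega>. (if t < V \<omega> then g \<omega> else 0) \<partial>M))"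
    using P.integrable_snd[OF inth] by simp
  have "(\<integral>t. indicator {0<..<1} t * (\<integral>\<omega>. (if t < V \<omega> then g \<omega> else 0) \<partial>M) \<partial>lborel) = (\<integral>t. (\<integral>\<omega>. ?h (\<omega>, t) \<partial>M) \<partial>lborel)"
    by simp
  also have "\<dots> = (\<integral>\<omega>. (\<integral>t. ?h (\<omega>, t) \<partial>lborel) \<partial>M)"
    using P.Fubini_integral[OF inth] by (simp only: case_prod_conv)
  also have "\<dots> = (\<integral>\<omega>. V \<omega> * g \<omega> \<partial>M)"
  proof (rule integral_cong_AE)
    show "AE \<omega> in M. (\<integral>t. ?h (\<omega>, t) \<partial>lborel) = V \<omega> * g \<omega>"
      using V eq by eventually_elim (simp only: case_prod_conv, simp)
  qed measurable
  finally show "(\<integral>\<omega>. V \<omega> * g \<omega> \<partial>M) = (\<integral>t. indicator {0<..<1} t * (\<integral>\<omega>. (if t < V \<omega> then g \<omega> else 0) \<partial>M) \<partial>lborel)"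
    by simp
qed

text \<open>The complement of the support is covered by balls of probability zero, and by Lindelof
  countably many of them suffice.\<close>

lemma AE_in_supp:
  fixes X :: "'a \<Rightarrow> real^'p"
  assumes [measurable]: "X \<in> borel_measurable M"
  shows "AE \<omega> in M. X \<omega> \<in> supp M X"
proof -
  let ?F = "{ball x e |x e. 0 < e \<and> prob {\<omega>\<in>space M. X \<omega> \<in> ball x e} = 0}"
  obtain F' where F': "F' \<subseteq> ?F" "countable F'" "\<Union>F' = \<Union>?F"
  proof (rule Lindelof[of ?F])
    show "open S" if "S \<in> ?F" for S using that by auto
  qed blast
  have "AE \<omega> in M. \<forall>B\<in>F'. X \<omega> \<notin> B"
  proof (rule AE_ball_countable'[OF _ F'(2)])
    fix B assume "B \<in> F'"
    then obtain x e where B: "B = ball x e" "prob {\<omega>\<in>space M. X \<omega> \<in> ball x e} = 0" using F' by auto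
    show "AE \<omega> in M. X \<omega> \<notin> B"
      by (rule AE_I'[of "{\<omega>\<in>space M. X \<omega> \<in> ball x e}"]) (use B in \<open>auto simp: null_sets_def emeasure_eq_measure\<close>)
  qed
  then show ?thesis
  proof eventually_elim
    case (elim \<omega>)
    then have X: "X \<omega> \<notin> \<Union>?F" unfolding F'(3)[symmetric] by blast
    show ?case
      unfolding supp_def
    proof (intro CollectI allI impI)
      fix e :: real assume "0 < e"
      then have "prob {\<omega>'\<in>space M. X \<omega>' \<in> ball (X \<omega>) e} \<noteq> 0"
        using X by (auto dest: spec[of _ "ball (X \<omega>) e"])
      then show "0 < prob {\<omega>'\<in>space M. X \<omega>' \<in> ball (X \<omega>) e}"
        by (simp add: zero_less_measure_iff)
    qed
  qed
qed

end

section \<open>Independence and conditional quantiles\<close>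

lemma borel_measurable_vec_nth[measurable]: "(\<lambda>x. x $ i) \<in> borel_measurable (borel :: (real^'p) measure)"
  by (intro borel_measurable_continuous_onI continuous_intros)

text \<open>Independence makes the mean of the product of the tail indicator with each coordinate of
  X factor. Part (iii) obtains its tail identity in this way.\<close>

lemma (in prob_space) indep_rv_tail:
  fixes X :: "'a \<Rightarrow> real^'p"
  assumes X: "integrable M X" and U: "unif01 M U" and ind: "indep_rv M U X" and t: "t \<in> {0<..<1}"
  shows "(\<integral>\<omega>. (if t < U \<omega> then X \<omega> else 0) \<partial>M) = (1 - t) *\<^sub>R (\<integral>\<omega>. X \<omega> \<partial>M)"
proof (rule vec_eq_iff[THEN iffD2], rule allI)
  fix i
  have [measurable]: "U \<in> borel_measurable M" "X \<in> borel_measurable M"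
    using ind by (auto simp: indep_rv_def)
  have Xi: "integrable M (\<lambda>\<omega>. X \<omega> $ i)"
    using integrable_bounded_linear[OF bounded_linear_vec_nth X] .
  have Xt: "integrable M (\<lambda>\<omega>. if t < U \<omega> then X \<omega> else 0)"
    by (rule Bochner_Integration.integrable_bound[OF X]) (use X in auto)
  have st: "Int_stable {W -` A \<inter> space M |A. A \<in> sets N}" for W :: "'a \<Rightarrow> 'c" and N
  proof (rule Int_stableI)
    fix a b assume "a \<in> {W -` A \<inter> space M |A. A \<in> sets N}" "b \<in> {W -` A \<inter> space M |A. A \<in> sets N}"
    then obtain A B where "a = W -` A \<inter> space M" "b = W -` B \<inter> space M" "A \<in> sets N" "B \<in> sets N" by auto
    then show "a \<inter> b \<in> {W -` A \<inter> space M |A. A \<in> sets N}" by (intro CollectI exI[of _ "A \<inter> B"]) auto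
  qed
  have "indep_set {U -` A \<inter> space M |A. A \<in> sets borel} {(\<lambda>\<omega>. X \<omega> $ i) -` B \<inter> space M |B. B \<in> sets borel}"
    unfolding indep_sets2_eq
  proof (intro conjI ballI)
    fix a b
    assume "a \<in> {U -` A \<inter> space M |A. A \<in> sets borel}" "b \<in> {(\<lambda>\<omega>. X \<omega> $ i) -` B \<inter> space M |B. B \<in> sets borel}"
    then obtain A B where AB: "A \<in> sets borel" "B \<in> sets borel"
      and ab: "a = {\<omega>\<in>space M. U \<omega> \<in> A}" "b = {\<omega>\<in>space M. X \<omega> \<in> (\<lambda>x. x $ i) -` B}" by auto
    have "(\<lambda>x. x $ i) -` B \<in> sets (borel :: (real^'p) measure)"
      using measurable_sets_borel[OF borel_measurable_vec_nth AB(2)] .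
    with ind AB(1) have "prob {\<omega>\<in>space M. U \<omega> \<in> A \<and> X \<omega> \<in> (\<lambda>x. x $ i) -` B} = prob a * prob b"
      unfolding indep_rv_def ab by blast
    moreover have "a \<inter> b = {\<omega>\<in>space M. U \<omega> \<in> A \<and> X \<omega> \<in> (\<lambda>x. x $ i) -` B}" by (auto simp: ab)
    ultimately show "prob (a \<inter> b) = prob a * prob b" by simp
  qed auto
  then have "indep_var borel U borel (\<lambda>\<omega>. X \<omega> $ i)"
    unfolding indep_var_eq by (intro conjI indep_set_sigma_sets st) auto
  then have "indep_var borel (indicator {t<..} \<circ> U) borel ((\<lambda>x. x) \<circ> (\<lambda>\<omega>. X \<omega> $ i))"
    by (rule indep_var_compose) auto
  then have iv: "indep_var borel (\<lambda>\<omega>. indicat_real {t<..} (U \<omega>)) borel (\<lambda>\<omega>. X \<omega> $ i)"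
    by (simp add: comp_def)
  have ti: "integrable M (\<lambda>\<omega>. indicat_real {t<..} (U \<omega>))"
    by (rule integrable_const_bound[of _ 1]) auto
  have "(\<integral>\<omega>. (if t < U \<omega> then X \<omega> else 0) \<partial>M) $ i = (\<integral>\<omega>. (if t < U \<omega> then X \<omega> else 0) $ i \<partial>M)"
    using integral_bounded_linear[OF bounded_linear_vec_nth Xt] by simp
  also have "\<dots> = (\<integral>\<omega>. indicat_real {t<..} (U \<omega>) * X \<omega> $ i \<partial>M)"
    by (intro Bochner_Integration.integral_cong) auto
  also have "\<dots> = (\<integral>\<omega>. indicat_real {t<..} (U \<omega>) \<partial>M) * (\<integral>\<omega>. X \<omega> $ i \<partial>M)"
    by (rule indep_var_lebesgue_integral[OF iv ti Xi])
  also have "(\<integral>\<omega>. indicat_real {t<..} (U \<omega>) \<partial>M) = (\<integral>\<omega>. indicator {\<omega>\<in>space M. t < U \<omega>} \<omega> \<partial>M)"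
    by (intro Bochner_Integration.integral_cong) (auto split: split_indicator)
  also have "\<dots> = 1 - t" using unif01_tail[OF U t] by (simp add: Int_absorb2)
  finally show "(\<integral>\<omega>. (if t < U \<omega> then X \<omega> else 0) \<partial>M) $ i = ((1 - t) *\<^sub>R (\<integral>\<omega>. X \<omega> \<partial>M)) $ i"
    using integral_bounded_linear[OF bounded_linear_vec_nth X] by simp
qed

text \<open>Without atoms the distribution function F is continuous. At the v-quantile q it
  satisfies F(q) >= v > u, so F still exceeds u slightly to the left of q, and the u-quantile lies
  strictly below q.\<close>

lemma (in real_distribution) quantile_strict_mono:
  assumes atomless: "\<And>x. measure M {x} = 0"
  shows "strict_mono_on {0<..<1} (\<lambda>u. Inf {y. u \<le> cdf M y})"
proof (rule strict_mono_onI)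
  fix u v :: real assume uv: "u \<in> {0<..<1}" "v \<in> {0<..<1}" "u < v"
  have cont: "isCont (cdf M) x" for x by (simp add: isCont_cdf atomless)
  have bdd: "bdd_below {y. w \<le> cdf M y}" if "0 < w" for w
  proof -
    have "eventually (\<lambda>x. cdf M x < w) at_bot"
      using order_tendstoD(2)[OF cdf_lim_at_bot that] .
    then obtain N where "\<And>x. x \<le> N \<Longrightarrow> cdf M x < w" by (auto simp: eventually_at_bot_linorder)
    then have "\<And>y. w \<le> cdf M y \<Longrightarrow> N \<le> y" by (meson linear not_le)
    then show ?thesis by (intro bdd_belowI[of _ N]) auto
  qed
  have "eventually (\<lambda>x. v < cdf M x) at_top"
    using order_tendstoD(1)[OF cdf_lim_at_top_prob, of v] uv by simp
  then have ne: "{y. v \<le> cdf M y} \<noteq> {}"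
    by (auto simp: eventually_at_top_linorder intro: less_imp_le)
  \<comment> \<open>Closedness makes the infimum attained, which gives F(q) >= v.\<close>
  have "closed {y. v \<le> cdf M y}"
    using cont by (intro closed_Collect_le continuous_at_imp_continuous_on) auto
  then have "Inf {y. v \<le> cdf M y} \<in> {y. v \<le> cdf M y}"
    using uv by (intro closed_contains_Inf ne bdd) auto
  moreover define q where "q = Inf {y. v \<le> cdf M y}"
  ultimately have "u < cdf M q" using uv by simp
  then have "eventually (\<lambda>y. u < cdf M y) (at_left q)"
    using cont[of q] unfolding isCont_def by (intro order_tendstoD(1)) (auto intro: filterlim_at_split[THEN iffD1, THEN conjunct1])
  then obtain l where "l < q" "\<And>y. l < y \<Longrightarrow> y < q \<Longrightarrow> u < cdf M y"
    by (auto simp: eventually_at_left_field)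
  moreover obtain y where "l < y" "y < q" using dense[OF \<open>l < q\<close>] by blast
  ultimately have "u \<le> cdf M y" "y < q" by (auto intro: less_imp_le)
  then show "Inf {y. u \<le> cdf M y} < Inf {y. v \<le> cdf M y}"
    using cInf_lower[OF _ bdd, of y u] uv by (simp add: q_def)
qed

text \<open>The integral inside \<open>cond_quantile\<close> is the distribution function of the
  probability measure with density f(., x), which has no atoms.\<close>

lemma cond_quantile_strict_mono:
  assumes [measurable]: "(\<lambda>y. f y x) \<in> borel_measurable borel" and nonneg: "\<And>y. 0 \<le> f y x"
    and int1: "(\<integral>\<^sup>+y. ennreal (f y x) \<partial>lborel) = 1"
  shows "strict_mono_on {0<..<1} (\<lambda>u. cond_quantile f u x)"
proof -
  define N where "N = density lborel (\<lambda>y. ennreal (f y x))"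
  have "prob_space N" by (rule prob_spaceI) (simp add: N_def emeasure_density int1)
  then interpret N: real_distribution N
    by (simp add: real_distribution_def real_distribution_axioms_def N_def)
  have "(\<integral>s. indicator {..y} s * f s x \<partial>lborel) = cdf N y" for y
  proof -
    have "cdf N y = (\<integral>s. indicator {..y} s \<partial>N)" by (simp add: cdf_def)
    also have "\<dots> = (\<integral>s. f s x *\<^sub>R indicator {..y} s \<partial>lborel)"
      unfolding N_def by (rule integral_density) (auto simp: nonneg)
    finally show ?thesis by (simp add: mult.commute)
  qed
  moreover have "measure N {y} = 0" for y
  proof -
    have "emeasure N {y} = 0"
      unfolding N_def by (subst emeasure_density) (auto simp: nn_integral_0_iff_AE intro!: AE_mp[OF AE_lborel_singleton[of y]])
    then show ?thesis by (simp add: measure_def)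
  qed
  ultimately show ?thesis
    using N.quantile_strict_mono by (simp add: cond_quantile_def)
qed

subsection \<open>The quantile regression loss\<close>

lemma rho_eq: "rho t z = max z 0 - (1 - t) * z"
  by (auto simp: rho_def max_def algebra_simps)

text \<open>The Bregman remainder of the positive part at z for the step -s, with subgradient 1(z >
  0). It is used with z = Y - X.b and s = X.h.\<close>

definition gap :: "real \<Rightarrow> real \<Rightarrow> real" where
  "gap z s = max (z - s) 0 - max z 0 + (if 0 < z then s else 0)"

lemma gap_nonneg: "0 \<le> gap z s"
  and gap_le: "gap z s \<le> \<bar>s\<bar>"
  and gap_eq_0_cases: "gap z s = 0 \<Longrightarrow> \<not> (0 < z \<and> z < s) \<and> \<not> (s < z \<and> z < 0)"
  by (auto simp: gap_def max_def)

text \<open>A step too short to reach the kink at zero stays on one linear piece of the positive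
  part.\<close>

lemma gap_small: "\<bar>s\<bar> < \<bar>z\<bar> \<Longrightarrow> gap z s = 0"
  by (auto simp: gap_def max_def)

text \<open>The condition on y describes the open interval between a and a + s. A nonzero value at a
  would persist on a one-sided neighbourhood inside that interval, which has positive
  length.\<close>

lemma continuous_zero_endpoint:
  fixes g :: "real \<Rightarrow> real"
  assumes cont: "continuous_on UNIV g" and s: "s \<noteq> 0"
    and ae: "AE y in lborel. (a < y \<and> y - a < s) \<or> (s < y - a \<and> y < a) \<longrightarrow> g y = 0"
  shows "g a = 0"
proof (rule ccontr)
  assume "g a \<noteq> 0"
  moreover have "isCont g a" using cont by (simp add: continuous_on_eq_continuous_at)
  ultimately obtain d where d: "0 < d" "\<And>y. dist a y < d \<Longrightarrow> g y \<noteq> 0"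
    using continuous_at_avoid[of a g 0] by auto
  \<comment> \<open>The interval starts at a, points in the direction of s and has length min d
    |s|.\<close>
  define l u where "l = (if 0 < s then a else a + max (- d) s)" and "u = (if 0 < s then a + min d s else a)"
  have lu: "l < u" using s d by (auto simp: l_def u_def)
  have "AE y in lborel. y \<notin> {l<..<u}"
    using ae by eventually_elim (use d(2) s in \<open>force simp: l_def u_def dist_real_def split: if_splits\<close>)
  then have "emeasure lborel {l<..<u} = 0"
    by (subst (asm) AE_iff_measurable[OF _ refl]) (auto simp: greaterThanLessThan_def greaterThan_def lessThan_def Int_def)
  with lu show False by simp
qed

section \<open>Joint law of the response and the regressors\<close>

locale linear_qr = prob_space M for M :: "'a measure" +
  fixes Y :: "'a \<Rightarrow> real" and X :: "'a \<Rightarrow> real^'p" and f :: "real \<Rightarrow> real^'p \<Rightarrow> real"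
  assumes Ymeas[measurable]: "Y \<in> borel_measurable M"
    and Xmeas[measurable]: "X \<in> borel_measurable M"
    and intY: "integrable M Y"
    and intX2: "integrable M (\<lambda>\<omega>. (norm (X \<omega>))\<^sup>2)"
    and dens: "cond_density M Y X f"
    and bdd: "\<exists>C. \<forall>y x. \<bar>f y x\<bar> \<le> C"
    and ucont: "uniformly_continuous_on UNIV (\<lambda>(y, x). f y x)"
begin

lemma f_nonneg: "0 \<le> f y x"
  using dens by (simp add: cond_density_def)

lemma f_meas[measurable]: "(\<lambda>(y, x). f y x) \<in> borel_measurable (borel \<Otimes>\<^sub>M borel)"
  using dens by (simp add: cond_density_def borel_prod)

lemma f_cont: "continuous_on UNIV (\<lambda>y. f y x)"
proof -
  have "continuous_on UNIV (\<lambda>y. (\<lambda>(y, x). f y x) (y, x))"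
    by (rule continuous_on_compose2[OF uniformly_continuous_imp_continuous[OF ucont]])
       (auto intro!: continuous_intros)
  then show ?thesis by simp
qed

text \<open>\<open>cond_density\<close> speaks of rectangles only; they are intersection stable and
  generate the product sigma-algebra. The full joint law is needed for events that compare Y with
  linear functions of X.\<close>

lemma joint_law:
  "distr M (borel \<Otimes>\<^sub>M borel) (\<lambda>\<omega>. (Y \<omega>, X \<omega>)) =
   density (lborel \<Otimes>\<^sub>M distr M borel X) (\<lambda>(y, x). ennreal (f y x))" (is "?L = ?R")
proof (rule measure_eqI_generator_eq[OF Int_stable_pair_measure_generator[of borel borel],
      where \<Omega>="UNIV" and A="\<lambda>_. UNIV \<times> UNIV"])
  interpret X: prob_space "distr M borel X" by (rule prob_space_distr) simp
  interpret P: pair_sigma_finite lborel "distr M borel X" ..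
  have s: "sets (lborel \<Otimes>\<^sub>M distr M borel X) = sets (borel \<Otimes>\<^sub>M (borel :: (real^'p) measure))"
    by (intro sets_pair_measure_cong) auto
  have fm[measurable]: "(\<lambda>(y, x). f y x) \<in> borel_measurable (lborel \<Otimes>\<^sub>M distr M borel X)"
    using f_meas by (simp add: measurable_cong_sets[OF s refl])
  fix Z :: "(real \<times> (real^'p)) set"
  assume "Z \<in> {a \<times> b |a b. a \<in> sets borel \<and> b \<in> sets borel}"
  then obtain A B where Z: "Z = A \<times> B" and [measurable]: "A \<in> sets borel" "B \<in> sets borel" by auto
  have "emeasure ?L Z = emeasure M {\<omega>\<in>space M. Y \<omega> \<in> A \<and> X \<omega> \<in> B}"
    unfolding Z by (subst emeasure_distr) (auto intro!: arg_cong[where f="emeasure M"])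
  also have "\<dots> = (\<integral>\<^sup>+\<omega>. indicator B (X \<omega>) * (\<integral>\<^sup>+y. indicator A y * ennreal (f y (X \<omega>)) \<partial>lborel) \<partial>M)"
    using dens by (simp add: cond_density_def)
  also have "\<dots> = (\<integral>\<^sup>+x. indicator B x * (\<integral>\<^sup>+y. indicator A y * ennreal (f y x) \<partial>lborel) \<partial>distr M borel X)"
    by (subst nn_integral_distr) auto
  also have "\<dots> = (\<integral>\<^sup>+x. (\<integral>\<^sup>+y. ennreal (f y x) * indicator Z (y, x) \<partial>lborel) \<partial>distr M borel X)"
    by (intro nn_integral_cong, subst nn_integral_cmult[symmetric])
       (auto simp: Z intro!: nn_integral_cong split: split_indicator)
  also have "\<dots> = (\<integral>\<^sup>+z. (case z of (y, x) \<Rightarrow> ennreal (f y x)) * indicator Z z \<partial>(lborel \<Otimes>\<^sub>M distr M borel X))"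
    by (subst P.nn_integral_snd[symmetric]) (auto simp: Z)
  also have "\<dots> = emeasure ?R Z"
    by (subst emeasure_density) (auto simp: Z)
  finally show "emeasure ?L Z = emeasure ?R Z" .
next
  have "sets (lborel \<Otimes>\<^sub>M distr M borel X) = sets (borel \<Otimes>\<^sub>M (borel :: (real^'p) measure))"
    by (intro sets_pair_measure_cong) auto
  then show "sets ?R = sigma_sets UNIV {a \<times> b |a b. a \<in> sets borel \<and> b \<in> sets borel}"
    by (simp add: sets_pair_measure space_pair_measure)
next
  interpret L: prob_space ?L by (rule prob_space_distr) simp
  show "emeasure ?L (UNIV \<times> UNIV) \<noteq> \<infinity>" by simp
next
  show "range (\<lambda>_. UNIV \<times> UNIV) \<subseteq> {a \<times> b |a b. a \<in> sets (borel :: real measure) \<and> b \<in> sets (borel :: (real^'p) measure)}"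
    by (intro image_subsetI CollectI exI[of _ UNIV]) simp
qed (auto simp: sets_pair_measure space_pair_measure)

lemma emeasure_joint:
  assumes [measurable]: "Measurable.pred (borel \<Otimes>\<^sub>M borel) (\<lambda>(y, x). S y x)"
  shows "emeasure M {\<omega>\<in>space M. S (Y \<omega>) (X \<omega>)} =
    (\<integral>\<^sup>+\<omega>. (\<integral>\<^sup>+y. ennreal (f y (X \<omega>)) * indicator {y. S y (X \<omega>)} y \<partial>lborel) \<partial>M)"
proof -
  interpret X: prob_space "distr M borel X" by (rule prob_space_distr) simp
  interpret P: pair_sigma_finite lborel "distr M borel X" ..
  have s: "sets (lborel \<Otimes>\<^sub>M distr M borel X) = sets (borel \<Otimes>\<^sub>M (borel :: (real^'p) measure))"
    by (intro sets_pair_measure_cong) auto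
  have fm[measurable]: "(\<lambda>(y, x). f y x) \<in> borel_measurable (lborel \<Otimes>\<^sub>M distr M borel X)"
    using f_meas by (simp add: measurable_cong_sets[OF s refl])
  let ?Z = "{z. case z of (y, x) \<Rightarrow> S y x}"
  have "?Z = {z \<in> space (borel \<Otimes>\<^sub>M borel). case z of (y, x) \<Rightarrow> S y x}"
    by (simp add: space_pair_measure)
  then have Z: "?Z \<in> sets (borel \<Otimes>\<^sub>M borel)"
    by (metis predE[OF assms])
  then have [measurable]: "?Z \<in> sets (lborel \<Otimes>\<^sub>M distr M borel X)" by (simp only: s)
  have "emeasure M {\<omega>\<in>space M. S (Y \<omega>) (X \<omega>)} = emeasure (distr M (borel \<Otimes>\<^sub>M borel) (\<lambda>\<omega>. (Y \<omega>, X \<omega>))) ?Z"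
    using Z by (subst emeasure_distr) (auto intro!: arg_cong[where f="emeasure M"])
  also have "\<dots> = (\<integral>\<^sup>+z. (case z of (y, x) \<Rightarrow> ennreal (f y x)) * indicator ?Z z \<partial>(lborel \<Otimes>\<^sub>M distr M borel X))"
    unfolding joint_law by (rule emeasure_density; measurable)
  also have "\<dots> = (\<integral>\<^sup>+x. (\<integral>\<^sup>+y. ennreal (f y x) * indicator ?Z (y, x) \<partial>lborel) \<partial>distr M borel X)"
    by (subst P.nn_integral_snd[symmetric]) auto
  also have "\<dots> = (\<integral>\<^sup>+\<omega>. (\<integral>\<^sup>+y. ennreal (f y (X \<omega>)) * indicator ?Z (y, X \<omega>) \<partial>lborel) \<partial>M)"
    using Z by (subst nn_integral_distr) auto
  finally show ?thesis
    by (simp add: indicator_def)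
qed

text \<open>For fixed x the event leaves a single value of y, a Lebesgue null set. So the kink of
  the loss is almost surely not hit.\<close>

lemma AE_neq: "AE \<omega> in M. Y \<omega> \<noteq> X \<omega> \<bullet> b"
proof (rule AE_I')
  have "emeasure M {\<omega>\<in>space M. Y \<omega> = X \<omega> \<bullet> b} =
     (\<integral>\<^sup>+\<omega>. (\<integral>\<^sup>+y. ennreal (f y (X \<omega>)) * indicator {y. y = X \<omega> \<bullet> b} y \<partial>lborel) \<partial>M)"
    by (rule emeasure_joint) simp
  also have "\<dots> = (\<integral>\<^sup>+\<omega>. 0 \<partial>M)"
  proof (intro nn_integral_cong)
    fix \<omega>
    have "AE y in lborel. y \<noteq> X \<omega> \<bullet> b" by (rule AE_lborel_singleton)
    then have "AE y in lborel. ennreal (f y (X \<omega>)) * indicator {y. y = X \<omega> \<bullet> b} y = 0"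
      by eventually_elim simp
    then have "(\<integral>\<^sup>+y. ennreal (f y (X \<omega>)) * indicator {y. y = X \<omega> \<bullet> b} y \<partial>lborel) = (\<integral>\<^sup>+y. 0 \<partial>(lborel :: real measure))"
      by (rule nn_integral_cong_AE)
    then show "(\<integral>\<^sup>+y. ennreal (f y (X \<omega>)) * indicator {y. y = X \<omega> \<bullet> b} y \<partial>lborel) = 0" by simp
  qed
  finally show "{\<omega>\<in>space M. Y \<omega> = X \<omega> \<bullet> b} \<in> null_sets M" by auto
qed auto

text \<open>Total mass one is extracted from \<open>cond_density\<close> by taking the whole line
  for the response: the mass function and the constant 1 are then densities of the same measure with
  respect to the law of X, and densities are unique almost everywhere.\<close>

lemma AE_density_integral: "AE \<omega> in M. (\<integral>\<^sup>+y. ennreal (f y (X \<omega>)) \<partial>lborel) = 1"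
proof -
  let ?h = "\<lambda>x. \<integral>\<^sup>+y. ennreal (f y x) \<partial>lborel"
  have eq: "AE x in distr M borel X. ?h x = 1"
  proof -
    have [measurable]: "?h \<in> borel_measurable borel" by measurable
    interpret X: prob_space "distr M borel X" by (rule prob_space_distr) simp
    have "density (distr M borel X) ?h = density (distr M borel X) (\<lambda>_. 1)"
    proof (rule measure_eqI)
      fix B assume "B \<in> sets (density (distr M borel X) ?h)"
      then have [measurable]: "B \<in> sets borel" by simp
      have "emeasure (distr M borel X) B = emeasure M {\<omega>\<in>space M. Y \<omega> \<in> UNIV \<and> X \<omega> \<in> B}"
        by (subst emeasure_distr) (auto intro!: arg_cong[where f="emeasure M"])
      also have "\<dots> = (\<integral>\<^sup>+\<omega>. indicator B (X \<omega>) * (\<integral>\<^sup>+y. indicator UNIV y * ennreal (f y (X \<omega>)) \<partial>lborel) \<partial>M)"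
        using dens[unfolded cond_density_def, THEN conjunct2, THEN conjunct2, THEN bspec[where x=UNIV], THEN bspec[where x=B]]
        by simp
      also have "\<dots> = (\<integral>\<^sup>+x. ?h x * indicator B x \<partial>distr M borel X)"
        by (subst nn_integral_distr) (auto simp: mult.commute)
      also have "\<dots> = emeasure (density (distr M borel X) ?h) B"
        by (subst emeasure_density) auto
      finally show "emeasure (density (distr M borel X) ?h) B = emeasure (density (distr M borel X) (\<lambda>_. 1)) B"
        by (simp add: emeasure_density)
    qed simp
    then show ?thesis
      by (subst (asm) X.density_unique_iff) auto
  qed
  then show ?thesis by (subst (asm) AE_distr_iff) auto
qed

lemma intX: "integrable M X"
proof (rule Bochner_Integration.integrable_bound)
  show "integrable M (\<lambda>\<omega>. 1 + (norm (X \<omega>))\<^sup>2)" using intX2 by simp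
  have "norm x \<le> norm (1 + (norm x)\<^sup>2)" for x :: "real^'p"
  proof -
    have "0 \<le> (norm x - 1)\<^sup>2" by simp
    then have "2 * norm x \<le> 1 + (norm x)\<^sup>2" by (simp add: power2_eq_square algebra_simps)
    then have "norm x \<le> 1 + (norm x)\<^sup>2" using norm_ge_zero[of x] by linarith
    then show ?thesis by simp
  qed
  then show "AE \<omega> in M. norm (X \<omega>) \<le> norm (1 + (norm (X \<omega>))\<^sup>2)" by simp
qed simp

section \<open>First-order condition for a minimizer\<close>

definition loss :: "real \<Rightarrow> real^'p \<Rightarrow> real" where
  "loss t b = (\<integral>\<omega>. rho t (Y \<omega> - X \<omega> \<bullet> b) \<partial>M)"

text \<open>Minus this vector is the derivative of the mean positive residual at b.\<close>

definition score :: "real^'p \<Rightarrow> real^'p" where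
  "score b = (\<integral>\<omega>. (if X \<omega> \<bullet> b < Y \<omega> then X \<omega> else 0) \<partial>M)"

definition mean_gap :: "real^'p \<Rightarrow> real^'p \<Rightarrow> real" where
  "mean_gap b h = (\<integral>\<omega>. gap (Y \<omega> - X \<omega> \<bullet> b) (X \<omega> \<bullet> h) \<partial>M)"

lemma is_qr_coef_iff: "is_qr_coef M Y X t b \<longleftrightarrow> (\<forall>c. loss t b \<le> loss t c)"
  by (simp add: is_qr_coef_def loss_def)

lemma integrable_residual: "integrable M (\<lambda>\<omega>. Y \<omega> - X \<omega> \<bullet> b)"
  using intY intX by simp

lemma integrable_pos_residual: "integrable M (\<lambda>\<omega>. max (Y \<omega> - X \<omega> \<bullet> b) 0)"
  using integrable_residual by simp

lemma loss_eq:
  "loss t b = (\<integral>\<omega>. max (Y \<omega> - X \<omega> \<bullet> b) 0 \<partial>M) - (1 - t) * ((\<integral>\<omega>. Y \<omega> \<partial>M) - (\<integral>\<omega>. X \<omega> \<partial>M) \<bullet> b)"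
  unfolding loss_def rho_eq using integrable_pos_residual integrable_residual intY intX
  by simp

lemma integrable_score: "integrable M (\<lambda>\<omega>. if X \<omega> \<bullet> b < Y \<omega> then X \<omega> else 0)"
  by (rule Bochner_Integration.integrable_bound[OF intX]) auto

lemma gap_meas[measurable]: "(\<lambda>(z, s). gap z s) \<in> borel_measurable (borel \<Otimes>\<^sub>M borel)"
  unfolding gap_def by measurable

lemma integrable_gap: "integrable M (\<lambda>\<omega>. gap (Y \<omega> - X \<omega> \<bullet> b) (X \<omega> \<bullet> h))"
proof (rule Bochner_Integration.integrable_bound)
  show "integrable M (\<lambda>\<omega>. X \<omega> \<bullet> h)" using intX by simp
qed (use gap_le gap_nonneg in auto)

lemma mean_gap_nonneg: "0 \<le> mean_gap b h"
  unfolding mean_gap_def by (simp add: gap_nonneg)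

text \<open>Exact first-order expansion of the loss: a linear term plus a nonnegative remainder. The
  first-order condition, uniqueness and convexity are all read off from it.\<close>

lemma loss_diff:
  "loss t (b + h) - loss t b = mean_gap b h + ((1 - t) *\<^sub>R (\<integral>\<omega>. X \<omega> \<partial>M) - score b) \<bullet> h"
proof -
  have "mean_gap b h = (\<integral>\<omega>. max (Y \<omega> - X \<omega> \<bullet> (b + h)) 0 - max (Y \<omega> - X \<omega> \<bullet> b) 0 +
      (if X \<omega> \<bullet> b < Y \<omega> then X \<omega> else 0) \<bullet> h \<partial>M)"
    unfolding mean_gap_def gap_def by (intro Bochner_Integration.integral_cong) (auto simp: inner_add_right algebra_simps)
  also have "\<dots> = (\<integral>\<omega>. max (Y \<omega> - X \<omega> \<bullet> (b + h)) 0 \<partial>M) - (\<integral>\<omega>. max (Y \<omega> - X \<omega> \<bullet> b) 0 \<partial>M) + score b \<bullet> h"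
    unfolding score_def using integrable_score integrable_pos_residual
    by (simp del: max_less_iff_conj)
  finally show ?thesis
    by (simp add: loss_eq inner_add_right inner_diff_left algebra_simps)
qed

text \<open>Dominated convergence with bound |X.h|. Since Y differs from X.b almost surely,
  \<open>gap_small\<close> makes the integrand vanish for all large n. The steps 1/(n+1) are enough
  to deduce the first-order condition.\<close>

lemma mean_gap_derivative: "(\<lambda>n. real (Suc n) * mean_gap b ((1 / real (Suc n)) *\<^sub>R h)) \<longlonglongrightarrow> 0"
proof -
  let ?g = "\<lambda>n \<omega>. real (Suc n) * gap (Y \<omega> - X \<omega> \<bullet> b) (X \<omega> \<bullet> ((1 / real (Suc n)) *\<^sub>R h))"
  have "(\<lambda>n. \<integral>\<omega>. ?g n \<omega> \<partial>M) \<longlonglongrightarrow> (\<integral>\<omega>. 0 \<partial>M)"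
  proof (rule integral_dominated_convergence)
    show "integrable M (\<lambda>\<omega>. \<bar>X \<omega> \<bullet> h\<bar>)" using intX by simp
    show "AE \<omega> in M. norm (?g n \<omega>) \<le> \<bar>X \<omega> \<bullet> h\<bar>" for n
    proof (rule AE_I2)
      fix \<omega>
      have "gap (Y \<omega> - X \<omega> \<bullet> b) (X \<omega> \<bullet> ((1 / real (Suc n)) *\<^sub>R h)) \<le> \<bar>X \<omega> \<bullet> h\<bar> / real (Suc n)"
        using gap_le[of "Y \<omega> - X \<omega> \<bullet> b" "X \<omega> \<bullet> ((1 / real (Suc n)) *\<^sub>R h)"] by (simp add: abs_mult)
      then show "norm (?g n \<omega>) \<le> \<bar>X \<omega> \<bullet> h\<bar>"
        by (simp add: abs_mult gap_nonneg field_simps del: of_nat_Suc)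
    qed
    show "AE \<omega> in M. (\<lambda>n. ?g n \<omega>) \<longlonglongrightarrow> 0"
      using AE_neq[of b]
    proof eventually_elim
      case (elim \<omega>)
      have "(\<lambda>n. \<bar>X \<omega> \<bullet> h\<bar> * inverse (real (Suc n))) \<longlonglongrightarrow> \<bar>X \<omega> \<bullet> h\<bar> * 0"
        by (intro tendsto_intros LIMSEQ_inverse_real_of_nat)
      then have "eventually (\<lambda>n. \<bar>X \<omega> \<bullet> h\<bar> * inverse (real (Suc n)) < \<bar>Y \<omega> - X \<omega> \<bullet> b\<bar>) sequentially"
        using elim by (intro order_tendstoD) auto
      then have "eventually (\<lambda>n. ?g n \<omega> = 0) sequentially"
        by eventually_elim (simp add: gap_small abs_mult divide_inverse mult.commute del: of_nat_Suc)
      then show ?case by (rule tendsto_eventually)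
    qed
  qed auto
  then show ?thesis by (simp add: mean_gap_def)
qed

text \<open>Sufficiency holds because the remainder is nonnegative. For necessity, step from the
  minimizer along minus the gradient D; in the limit of short steps minimality yields 0 <=
  -|D|^2.\<close>

lemma qr_coef_iff_score: "is_qr_coef M Y X t b \<longleftrightarrow> score b = (1 - t) *\<^sub>R (\<integral>\<omega>. X \<omega> \<partial>M)"
proof
  assume s: "score b = (1 - t) *\<^sub>R (\<integral>\<omega>. X \<omega> \<partial>M)"
  show "is_qr_coef M Y X t b"
    unfolding is_qr_coef_iff
  proof
    fix c show "loss t b \<le> loss t c"
      using loss_diff[of t b "c - b"] mean_gap_nonneg[of b "c - b"] by (simp add: s)
  qed
next
  assume m: "is_qr_coef M Y X t b"
  define D where "D = (1 - t) *\<^sub>R (\<integral>\<omega>. X \<omega> \<partial>M) - score b"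
  have "0 \<le> real (Suc n) * mean_gap b ((1 / real (Suc n)) *\<^sub>R (- D)) + D \<bullet> (- D)" for n
  proof -
    have "loss t b \<le> loss t (b + (1 / real (Suc n)) *\<^sub>R (- D))"
      using m unfolding is_qr_coef_iff by blast
    then have "0 \<le> mean_gap b ((1 / real (Suc n)) *\<^sub>R (- D)) + D \<bullet> ((1 / real (Suc n)) *\<^sub>R (- D))"
      using loss_diff[of t b "(1 / real (Suc n)) *\<^sub>R (- D)"] by (simp add: D_def)
    then have "0 \<le> real (Suc n) * (mean_gap b ((1 / real (Suc n)) *\<^sub>R (- D)) + D \<bullet> ((1 / real (Suc n)) *\<^sub>R (- D)))"
      by (intro mult_nonneg_nonneg) auto
    then show ?thesis by (simp add: field_simps del: of_nat_Suc)
  qed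
  moreover have "(\<lambda>n. real (Suc n) * mean_gap b ((1 / real (Suc n)) *\<^sub>R (- D)) + D \<bullet> (- D)) \<longlonglongrightarrow> 0 + D \<bullet> (- D)"
    by (intro tendsto_intros mean_gap_derivative)
  ultimately have "0 \<le> 0 + D \<bullet> (- D)"
    by (intro LIMSEQ_le_const) auto
  then have "D = 0"
    by (metis add_0 inner_ge_zero inner_gt_zero_iff inner_minus_right neg_0_le_iff_le not_le)
  then show "score b = (1 - t) *\<^sub>R (\<integral>\<omega>. X \<omega> \<partial>M)" by (simp add: D_def)
qed

section \<open>Uniqueness of the minimizer\<close>

lemma jac_integrable: "integrable M (\<lambda>\<omega>. f (X \<omega> \<bullet> b) (X \<omega>) * X \<omega> $ i * X \<omega> $ j)"
proof -
  obtain C where C: "\<And>y x. \<bar>f y x\<bar> \<le> C" using bdd by auto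
  show ?thesis
  proof (rule Bochner_Integration.integrable_bound)
    show "integrable M (\<lambda>\<omega>. C * (norm (X \<omega>))\<^sup>2)" using intX2 by simp
    have "\<bar>f y x * x $ i * x $ j\<bar> \<le> \<bar>C * (norm x)\<^sup>2\<bar>" for y x
    proof -
      have "\<bar>f y x\<bar> * (\<bar>x $ i\<bar> * \<bar>x $ j\<bar>) \<le> C * (norm x * norm x)"
        using C[of y x] by (intro mult_mono component_le_norm_cart) auto
      moreover have "0 \<le> C" using C[of 0 0] by linarith
      ultimately show ?thesis by (simp add: abs_mult power2_eq_square mult.assoc)
    qed
    then show "AE \<omega> in M. norm (f (X \<omega> \<bullet> b) (X \<omega>) * X \<omega> $ i * X \<omega> $ j) \<le> norm (C * (norm (X \<omega>))\<^sup>2)"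
      by simp
  qed simp
qed

text \<open>Equal losses force the nonnegative remainder between b and c to have mean zero, hence to
  vanish almost surely. The joint law turns this into vanishing of the density between X.b and X.c,
  continuity carries it to the endpoint X.b, and the Jacobian at b then annihilates c - b.\<close>

lemma qr_coef_unique:
  assumes b: "is_qr_coef M Y X t b" and c: "is_qr_coef M Y X t c"
    and rank: "rank (jac_mat M X f b) = CARD('p)"
  shows "c = b"
proof -
  define h where "h = c - b"
  have "loss t b = loss t c" using b c by (auto simp: is_qr_coef_iff intro: antisym)
  then have "mean_gap b h = 0"
    using loss_diff[of t b h] b by (simp add: qr_coef_iff_score h_def)
  then have gap0: "AE \<omega> in M. gap (Y \<omega> - X \<omega> \<bullet> b) (X \<omega> \<bullet> h) = 0"
    unfolding mean_gap_def by (subst (asm) integral_nonneg_eq_0_iff_AE[OF integrable_gap]) (auto simp: gap_nonneg)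
  \<comment> \<open>\<open>S\<close> says that y lies strictly between x.b and x.(b + h), in either
    order.\<close>
  define S where "S y x \<longleftrightarrow> (x \<bullet> b < y \<and> y - x \<bullet> b < x \<bullet> h) \<or> (x \<bullet> h < y - x \<bullet> b \<and> y < x \<bullet> b)" for y and x :: "real^'p"
  have Smeas[measurable]: "Measurable.pred (borel \<Otimes>\<^sub>M borel) (\<lambda>(y, x). S y x)"
    unfolding S_def by measurable
  have "AE \<omega> in M. \<not> S (Y \<omega>) (X \<omega>)"
    using gap0 by eventually_elim (auto simp: S_def dest!: gap_eq_0_cases)
  then have "emeasure M {\<omega>\<in>space M. S (Y \<omega>) (X \<omega>)} = 0"
    by (subst (asm) AE_iff_measurable[OF _ refl]) (auto)
  then have "AE \<omega> in M. (\<integral>\<^sup>+y. ennreal (f y (X \<omega>)) * indicator {y. S y (X \<omega>)} y \<partial>lborel) = 0"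
    unfolding emeasure_joint[OF Smeas] by (subst (asm) nn_integral_0_iff_AE) (auto simp: indicator_def)
  then have "AE \<omega> in M. f (X \<omega> \<bullet> b) (X \<omega>) * (X \<omega> \<bullet> h) = 0"
  proof eventually_elim
    case (elim \<omega>)
    show ?case
    proof (cases "X \<omega> \<bullet> h = 0")
      case False
      have "AE y in lborel. ennreal (f y (X \<omega>)) * indicator {y. S y (X \<omega>)} y = 0"
        using elim by (subst (asm) nn_integral_0_iff_AE) (auto simp: indicator_def)
      then have "AE y in lborel. (X \<omega> \<bullet> b < y \<and> y - X \<omega> \<bullet> b < X \<omega> \<bullet> h) \<or> (X \<omega> \<bullet> h < y - X \<omega> \<bullet> b \<and> y < X \<omega> \<bullet> b) \<longrightarrow> f y (X \<omega>) = 0"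
        by eventually_elim (use f_nonneg in \<open>auto simp: S_def indicator_def ennreal_eq_0_iff intro: antisym split: if_splits\<close>)
      from continuous_zero_endpoint[OF f_cont False this] show ?thesis by simp
    qed simp
  qed
  \<comment> \<open>Multiplied by coordinate i, the vanishing quantity becomes the integrand of
    component i of the Jacobian applied to h.\<close>
  then have ae: "AE \<omega> in M. X \<omega> $ i * (f (X \<omega> \<bullet> b) (X \<omega>) * (X \<omega> \<bullet> h)) = 0" for i
    by eventually_elim simp
  have "jac_mat M X f b *v h = 0"
  proof (rule vec_eq_iff[THEN iffD2], rule allI)
    fix i
    have "(jac_mat M X f b *v h) $ i = (\<Sum>j\<in>UNIV. (\<integral>\<omega>. f (X \<omega> \<bullet> b) (X \<omega>) * X \<omega> $ i * X \<omega> $ j \<partial>M) * h $ j)"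
      by (simp add: matrix_vector_mult_def jac_mat_def)
    also have "\<dots> = (\<integral>\<omega>. (\<Sum>j\<in>UNIV. f (X \<omega> \<bullet> b) (X \<omega>) * X \<omega> $ i * X \<omega> $ j * h $ j) \<partial>M)"
      using jac_integrable by simp
    also have "\<dots> = (\<integral>\<omega>. X \<omega> $ i * (f (X \<omega> \<bullet> b) (X \<omega>) * (X \<omega> \<bullet> h)) \<partial>M)"
      by (intro Bochner_Integration.integral_cong) (auto simp: inner_vec_def[of _ h] sum_distrib_left ac_simps)
    also have "\<dots> = (\<integral>\<omega>. 0 \<partial>M)" using ae by (intro integral_cong_AE) auto
    finally show "(jac_mat M X f b *v h) $ i = 0 $ i" by simp
  qed
  moreover have "inj ((*v) (jac_mat M X f b))"
    using rank by (simp add: full_rank_injective)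
  ultimately have "h = 0"
    by (metis injD matrix_vector_mult_0_right)
  then show ?thesis by (simp add: h_def)
qed

section \<open>Convexity of the loss and continuity in the level\<close>

lemma loss_subgradient:
  "((1 - t) *\<^sub>R (\<integral>\<omega>. X \<omega> \<partial>M) - score d) \<bullet> (b - d) \<le> loss t b - loss t d"
  using loss_diff[of t d "b - d"] mean_gap_nonneg[of d "b - d"] by simp

text \<open>There is a supporting affine function at every point. At the convex combination d,
  averaging its inequalities at b and c cancels the linear terms.\<close>

lemma loss_convex: "convex_on UNIV (loss t)"
proof (rule convex_onI)
  fix u :: real and b c :: "real^'p"
  assume u: "0 < u" "u < 1"
  define d where "d = (1 - u) *\<^sub>R b + u *\<^sub>R c"
  define D where "D = (1 - t) *\<^sub>R (\<integral>\<omega>. X \<omega> \<partial>M) - score d"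
  have "(1 - u) * (D \<bullet> (b - d)) + u * (D \<bullet> (c - d)) = D \<bullet> ((1 - u) *\<^sub>R (b - d) + u *\<^sub>R (c - d))"
    by (simp add: inner_add_right)
  also have "(1 - u) *\<^sub>R (b - d) + u *\<^sub>R (c - d) = 0"
    by (simp add: d_def algebra_simps)
  finally have "0 = (1 - u) * (D \<bullet> (b - d)) + u * (D \<bullet> (c - d))" by simp
  also have "\<dots> \<le> (1 - u) * (loss t b - loss t d) + u * (loss t c - loss t d)"
    using u loss_subgradient[of t d b] loss_subgradient[of t d c]
    by (intro add_mono mult_left_mono) (auto simp: D_def)
  finally show "loss t ((1 - u) *\<^sub>R b + u *\<^sub>R c) \<le> (1 - u) * loss t b + u * loss t c"
    by (simp add: d_def algebra_simps)
qed simp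

lemma loss_continuous: "continuous_on UNIV (loss t)"
  by (rule convex_on_continuous[OF open_UNIV loss_convex])

text \<open>The level enters the loss only through an affine function of b, so excess losses at
  nearby levels differ little on bounded sets.\<close>

lemma loss_change_level:
  "loss t c - loss t b = loss s c - loss s b + (s - t) * ((\<integral>\<omega>. X \<omega> \<partial>M) \<bullet> (c - b))"
  by (simp add: loss_eq inner_diff_right algebra_simps)

text \<open>By uniqueness the excess loss at level s is bounded below by some positive \<delta> on a
  sphere around \<beta>(s). It remains positive there for levels t close to s, and convexity then
  excludes a minimizer at level t on or outside the sphere.\<close>

lemma qr_coef_continuous:
  assumes T: "open T" and beta: "\<And>t. t \<in> T \<Longrightarrow> is_qr_coef M Y X t (\<beta> t)"
    and rank: "\<And>t. t \<in> T \<Longrightarrow> rank (jac_mat M X f (\<beta> t)) = CARD('p)"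
  shows "continuous_on T \<beta>"
proof (rule continuous_at_imp_continuous_on, rule ballI)
  fix s assume s: "s \<in> T"
  define b where "b = \<beta> s"
  define m where "m = (\<integral>\<omega>. X \<omega> \<partial>M)"
  show "isCont \<beta> s"
    unfolding continuous_at_eps_delta
  proof (intro allI impI)
    fix e :: real assume e: "0 < e"
    have "compact (sphere b e)" "sphere b e \<noteq> {}" using e by auto
    then obtain c0 where c0: "c0 \<in> sphere b e" "\<And>c. c \<in> sphere b e \<Longrightarrow> loss s c0 \<le> loss s c"
      using continuous_attains_inf[of "sphere b e" "loss s"] continuous_on_subset[OF loss_continuous] by blast
    define \<delta> where "\<delta> = loss s c0 - loss s b"
    have "c0 \<noteq> b" using c0 e by auto
    then have "\<not> is_qr_coef M Y X s c0"
      using qr_coef_unique[OF beta[OF s] _ rank[OF s]] by (auto simp: b_def)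
    then have \<delta>: "0 < \<delta>"
      using beta[OF s] unfolding is_qr_coef_iff \<delta>_def b_def by (metis diff_gt_0_iff_gt not_le order_trans)
    obtain r where r: "0 < r" "\<And>t. dist t s < r \<Longrightarrow> t \<in> T"
      using T s by (auto simp: open_dist)
    \<comment> \<open>Within r the level stays in \<open>T\<close>; the second bound keeps the
      change of the excess loss on the sphere below \<delta>. The added 1 keeps the denominator
      positive when the mean m is zero.\<close>
    define d where "d = min r (\<delta> / (norm m * e + 1))"
    have pos: "0 < norm m * e + 1" using e by (simp add: add_nonneg_pos)
    have "0 < d" using r \<delta> pos by (simp add: d_def)
    moreover have "dist (\<beta> t) (\<beta> s) < e" if t: "dist t s < d" for t
    proof (rule ccontr)
      assume "\<not> dist (\<beta> t) (\<beta> s) < e"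
      then have far: "e \<le> norm (\<beta> t - b)" by (simp add: dist_norm b_def)
      have tT: "t \<in> T" using t r by (simp add: d_def)
      \<comment> \<open>With this u the point \<open>c\<close> below is where the segment from b to
        \<beta>(t) meets the sphere.\<close>
      define u where "u = e / norm (\<beta> t - b)"
      have npos: "0 < norm (\<beta> t - b)" using e far by linarith
      then have u: "0 < u" "u \<le> 1" using e far by (auto simp: u_def simp del: zero_less_norm_iff)
      define c where "c = (1 - u) *\<^sub>R b + u *\<^sub>R \<beta> t"
      have cb: "c - b = u *\<^sub>R (\<beta> t - b)" by (simp add: c_def algebra_simps)
      have ncb: "norm (c - b) = e" using e npos by (simp add: cb u_def)
      then have "c \<in> sphere b e" by (simp add: dist_norm norm_minus_commute)
      then have "\<delta> \<le> loss s c - loss s b" using c0(2) by (simp add: \<delta>_def)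
      moreover have "\<bar>(s - t) * (m \<bullet> (c - b))\<bar> < \<delta>"
      proof -
        have "\<bar>(s - t) * (m \<bullet> (c - b))\<bar> \<le> \<bar>s - t\<bar> * (norm m * e)"
          using Cauchy_Schwarz_ineq2[of m "c - b"] by (simp add: abs_mult ncb mult_left_mono)
        also have "\<dots> \<le> \<bar>s - t\<bar> * (norm m * e + 1)" by (intro mult_left_mono) auto
        also have "\<dots> < \<delta> / (norm m * e + 1) * (norm m * e + 1)"
          using t pos by (intro mult_strict_right_mono) (auto simp: d_def dist_real_def)
        also have "\<dots> = \<delta>" using pos by simp
        finally show ?thesis .
      qed
      ultimately have "loss t b < loss t c"
        using loss_change_level[of t c b s] by (simp add: m_def abs_less_iff)
      moreover have "loss t c \<le> (1 - u) * loss t b + u * loss t (\<beta> t)"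
        unfolding c_def using convex_onD[OF loss_convex, of u b "\<beta> t" t] u by simp
      moreover have "u * loss t (\<beta> t) \<le> u * loss t b"
        using beta[OF tT] u by (intro mult_left_mono) (auto simp: is_qr_coef_iff)
      ultimately show False by (simp add: algebra_simps)
    qed
    ultimately show "\<exists>d>0. \<forall>t. dist t s < d \<longrightarrow> dist (\<beta> t) (\<beta> s) < e" by blast
  qed
qed

end

subsection \<open>The quantile regression process\<close>

text \<open>By monotonicity the level set is an initial interval of (0,1), so comparing it with
  (0,t) decides everything except possibly t = m y. With g(t) = X.\<beta>(t) and y = Y the number m
  y is \<open>Utilde\<close>.\<close>

lemma level_measure:
  fixes g :: "real \<Rightarrow> real"
  assumes g: "strict_mono_on {0<..<1} g"
  defines "m \<equiv> \<lambda>y. measure lborel {t\<in>{0<..<1}. g t < y}"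
  shows level_measure_gt: "t \<in> {0<..<1} \<Longrightarrow> t < m y \<Longrightarrow> g t < y"
    and level_measure_ge: "t \<in> {0<..<1} \<Longrightarrow> g t < y \<Longrightarrow> t \<le> m y"
    and level_measure_eq: "t \<in> {0<..<1} \<Longrightarrow> m (g t) = t"
proof -
  have fm: "{t\<in>{0<..<1}. g t < y} \<in> fmeasurable lborel" for y
  proof (rule fmeasurableI2)
    show "{0<..<1::real} \<in> fmeasurable lborel" by (auto simp: fmeasurable_def)
    \<comment> \<open>Being an interval gives measurability of the level set from monotonicity
      alone.\<close>
    have "is_interval {t\<in>{0<..<1}. g t < y}"
      unfolding is_interval_1
    proof (intro ballI allI impI)
      fix a b x assume ab: "a \<in> {t\<in>{0<..<1}. g t < y}" "b \<in> {t\<in>{0<..<1}. g t < y}" "a \<le> x \<and> x \<le> b"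
      then have "x \<in> {0<..<1}" "g x \<le> g b"
        using strict_mono_on_leD[OF g, of x b] by auto
      with ab show "x \<in> {t\<in>{0<..<1}. g t < y}" by auto
    qed
    then show "{t\<in>{0<..<1}. g t < y} \<in> sets lborel" by (simp add: real_interval_borel_measurable)
  qed auto
  have f0: "{0<..<t::real} \<in> fmeasurable lborel" for t
    by (cases "0 \<le> t") (auto simp: fmeasurable_def)
  show "g t < y" if t: "t \<in> {0<..<1}" "t < m y"
  proof (rule ccontr)
    assume "\<not> g t < y"
    then have "{t\<in>{0<..<1}. g t < y} \<subseteq> {0<..<t}"
      using strict_mono_on_leD[OF g t(1)] by (force simp: not_less)
    then have "m y \<le> measure lborel {0<..<t}"
      unfolding m_def by (rule measure_mono_fmeasurable[OF _ fmeasurableD[OF fm] f0])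
    with t show False by simp
  qed
  show "t \<le> m y" if t: "t \<in> {0<..<1}" "g t < y"
  proof -
    have "{0<..<t} \<subseteq> {t\<in>{0<..<1}. g t < y}"
    proof
      fix x assume "x \<in> {0<..<t}"
      then show "x \<in> {t\<in>{0<..<1}. g t < y}"
        using strict_mono_onD[OF g, of x t] t by auto
    qed
    then have "measure lborel {0<..<t} \<le> m y"
      unfolding m_def by (rule measure_mono_fmeasurable[OF _ _ fm]) simp
    then show ?thesis using t by simp
  qed
  show "m (g t) = t" if t: "t \<in> {0<..<1}"
  proof -
    have "{s\<in>{0<..<1}. g s < g t} = {0<..<t}"
      using t strict_mono_on_less[OF g _ t] by auto
    then show ?thesis using t by (simp add: m_def)
  qed
qed

lemma Utilde_eq_measure:
  "Utilde Y X \<beta> \<omega> = measure lborel {t\<in>{0<..<1}. X \<omega> \<bullet> \<beta> t < Y \<omega>}"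
proof -
  have "Utilde Y X \<beta> \<omega> = (\<integral>t. indicator {0<..<1} t * (if X \<omega> \<bullet> \<beta> t < Y \<omega> then 1 else 0) \<partial>lborel)"
    by (simp add: Utilde_def interval_lebesgue_integral_def set_lebesgue_integral_def zero_ereal_def one_ereal_def)
  also have "\<dots> = (\<integral>t. indicator {t\<in>{0<..<1}. X \<omega> \<bullet> \<beta> t < Y \<omega>} t \<partial>lborel)"
    by (intro Bochner_Integration.integral_cong) (auto split: split_indicator)
  finally show ?thesis by simp
qed

lemma Utilde_measurable:
  assumes [measurable]: "Y \<in> borel_measurable M" "X \<in> borel_measurable M"
    and cont: "continuous_on {0<..<1} \<beta>"
  shows "Utilde Y X \<beta> \<in> borel_measurable M"
proof -
  \<comment> \<open>The behaviour of \<beta> outside (0,1) is arbitrary; extending by zero gives a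
    Borel function without changing the integral, and measurability of a parameter integral
    applies.\<close>
  define \<gamma> where "\<gamma> t = indicat_real {0<..<1} t *\<^sub>R \<beta> t" for t
  have [measurable]: "\<gamma> \<in> borel_measurable borel"
    unfolding \<gamma>_def[abs_def] by (rule borel_measurable_continuous_on_indicator[OF _ cont]) simp
  have "Utilde Y X \<beta> = (\<lambda>\<omega>. \<integral>t. (if 0 < t \<and> t < 1 \<and> X \<omega> \<bullet> \<gamma> t < Y \<omega> then 1 else 0) \<partial>lborel)"
  proof
    fix \<omega>
    have "Utilde Y X \<beta> \<omega> = (\<integral>t. indicator {t\<in>{0<..<1}. X \<omega> \<bullet> \<beta> t < Y \<omega>} t \<partial>lborel)"
      by (simp add: Utilde_eq_measure)
    also have "\<dots> = (\<integral>t. (if 0 < t \<and> t < 1 \<and> X \<omega> \<bullet> \<gamma> t < Y \<omega> then 1 else 0) \<partial>lborel)"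
      by (intro Bochner_Integration.integral_cong) (auto simp: \<gamma>_def indicator_def)
    finally show "Utilde Y X \<beta> \<omega> = (\<integral>t. (if 0 < t \<and> t < 1 \<and> X \<omega> \<bullet> \<gamma> t < Y \<omega> then 1 else 0) \<partial>lborel)" .
  qed
  also have "\<dots> \<in> borel_measurable M"
    by measurable
  finally show ?thesis .
qed

locale linear_qr_process = linear_qr M Y X f
  for M :: "'a measure" and Y and X :: "'a \<Rightarrow> real^'p" and f +
  fixes \<beta> :: "real \<Rightarrow> real^'p"
  assumes beta: "t \<in> {0<..<1} \<Longrightarrow> is_qr_coef M Y X t (\<beta> t)"
    and rank: "t \<in> {0<..<1} \<Longrightarrow> rank (jac_mat M X f (\<beta> t)) = CARD('p)"
begin

lemma beta_continuous: "continuous_on {0<..<1} \<beta>"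
  by (rule qr_coef_continuous) (auto intro: beta rank)

lemma Utilde_meas[measurable]: "Utilde Y X \<beta> \<in> borel_measurable M"
  by (rule Utilde_measurable[OF Ymeas Xmeas beta_continuous])

lemma score_beta: "t \<in> {0<..<1} \<Longrightarrow> score (\<beta> t) = (1 - t) *\<^sub>R (\<integral>\<omega>. X \<omega> \<partial>M)"
  using beta by (simp add: qr_coef_iff_score)

text \<open>Monotonicity makes V > t and Y > X.\<gamma>(t) the same event, so the tail identity is
  the first-order condition for \<gamma>(t). The tail identity is the hypothesis because (ii)
  derives it from mean independence and (iii) from independence. Monotonicity is asked of \<gamma>,
  since (iii) does not assume it of \<beta>.\<close>

lemma representation_unique:
  assumes V: "unif01 M V"
    and tail: "\<And>t. t \<in> {0<..<1} \<Longrightarrow>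
      (\<integral>\<omega>. (if t < V \<omega> then X \<omega> else 0) \<partial>M) = (1 - t) *\<^sub>R (\<integral>\<omega>. X \<omega> \<partial>M)"
    and rep: "AE \<omega> in M. Y \<omega> = X \<omega> \<bullet> \<gamma> (V \<omega>)"
    and mono: "AE \<omega> in M. strict_mono_on {0<..<1} (\<lambda>u. X \<omega> \<bullet> \<gamma> u)"
  shows "\<And>t. t \<in> {0<..<1} \<Longrightarrow> \<gamma> t = \<beta> t"
    and "AE \<omega> in M. Utilde Y X \<beta> \<omega> = V \<omega>"
proof -
  note [measurable] = unif01_measurable[OF V]
  show eq: "\<gamma> t = \<beta> t" if t: "t \<in> {0<..<1}" for t
  proof -
    have "AE \<omega> in M. (if X \<omega> \<bullet> \<gamma> t < Y \<omega> then X \<omega> else 0) = (if t < V \<omega> then X \<omega> else 0)"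
      using rep mono unif01_AE[OF V]
    proof eventually_elim
      case (elim \<omega>)
      then show ?case using strict_mono_on_less[OF elim(2) t elim(3)] by simp
    qed
    then have "score (\<gamma> t) = (\<integral>\<omega>. (if t < V \<omega> then X \<omega> else 0) \<partial>M)"
      unfolding score_def by (intro integral_cong_AE) auto
    then have "is_qr_coef M Y X t (\<gamma> t)" using tail[OF t] by (simp add: qr_coef_iff_score)
    then show ?thesis by (rule qr_coef_unique[OF beta[OF t] _ rank[OF t]])
  qed
  show "AE \<omega> in M. Utilde Y X \<beta> \<omega> = V \<omega>"
    using rep mono unif01_AE[OF V]
  proof eventually_elim
    case (elim \<omega>)
    have "Utilde Y X \<beta> \<omega> = measure lborel {t\<in>{0<..<1}. X \<omega> \<bullet> \<gamma> t < X \<omega> \<bullet> \<gamma> (V \<omega>)}"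
      unfolding Utilde_eq_measure by (intro arg_cong[where f="measure lborel"]) (use elim eq in auto)
    then show ?case using level_measure_eq[OF elim(2,3)] by simp
  qed
qed

section \<open>Representation and optimality under monotonicity\<close>

context
  fixes i1
  assumes intercept: "\<And>\<omega>. \<omega> \<in> space M \<Longrightarrow> X \<omega> $ i1 = 1"
    and mono: "\<And>x. x \<in> supp M X \<Longrightarrow> strict_mono_on {0<..<1} (\<lambda>t. x \<bullet> \<beta> t)"
begin

lemma AE_mono: "AE \<omega> in M. strict_mono_on {0<..<1} (\<lambda>t. X \<omega> \<bullet> \<beta> t)"
  using AE_in_supp[OF Xmeas] by eventually_elim (rule mono)

text \<open>This is the intercept component of the first-order condition: as that coordinate of X is
  1, it reads off the probability itself.\<close>

lemma prob_exceed:
  assumes t: "t \<in> {0<..<1}"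
  shows "prob {\<omega>\<in>space M. X \<omega> \<bullet> \<beta> t < Y \<omega>} = 1 - t"
proof -
  have "prob {\<omega>\<in>space M. X \<omega> \<bullet> \<beta> t < Y \<omega>} = (\<integral>\<omega>. indicator {\<omega>\<in>space M. X \<omega> \<bullet> \<beta> t < Y \<omega>} \<omega> \<partial>M)"
    by (simp add: Int_absorb2)
  also have "\<dots> = (\<integral>\<omega>. (if X \<omega> \<bullet> \<beta> t < Y \<omega> then X \<omega> else 0) $ i1 \<partial>M)"
    by (intro Bochner_Integration.integral_cong) (auto simp: intercept)
  also have "\<dots> = score (\<beta> t) $ i1"
    unfolding score_def using integral_bounded_linear[OF bounded_linear_vec_nth integrable_score] by simp
  also have "\<dots> = (1 - t) * (\<integral>\<omega>. X \<omega> \<partial>M) $ i1" by (simp add: score_beta[OF t])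
  also have "(\<integral>\<omega>. X \<omega> \<partial>M) $ i1 = (\<integral>\<omega>. X \<omega> $ i1 \<partial>M)"
    using integral_bounded_linear[OF bounded_linear_vec_nth intX] by simp
  also have "\<dots> = (\<integral>\<omega>. 1 \<partial>M)" by (intro Bochner_Integration.integral_cong) (auto simp: intercept)
  finally show ?thesis by (simp add: prob_space)
qed

lemma AE_Utilde_gt:
  assumes t: "t \<in> {0<..<1}"
  shows "AE \<omega> in M. t < Utilde Y X \<beta> \<omega> \<longrightarrow> X \<omega> \<bullet> \<beta> t < Y \<omega>"
  using AE_mono unfolding Utilde_eq_measure
proof eventually_elim
  case (elim \<omega>)
  show ?case using level_measure_gt[OF elim t] by (rule impI)
qed

lemma AE_Utilde_ge:
  assumes t: "t \<in> {0<..<1}"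
  shows "AE \<omega> in M. X \<omega> \<bullet> \<beta> t < Y \<omega> \<longrightarrow> t \<le> Utilde Y X \<beta> \<omega>"
  using AE_mono unfolding Utilde_eq_measure
proof eventually_elim
  case (elim \<omega>)
  show ?case using level_measure_ge[OF elim t] by (rule impI)
qed

text \<open>The upper bound is direct. The lower bound passes through levels s > t, because
  \<open>AE_Utilde_ge\<close> gives only a weak inequality; then s decreases to t.\<close>

lemma prob_Utilde_gt:
  assumes t: "t \<in> {0<..<1}"
  shows "prob {\<omega>\<in>space M. t < Utilde Y X \<beta> \<omega>} = 1 - t"
proof (rule antisym)
  have "prob {\<omega>\<in>space M. t < Utilde Y X \<beta> \<omega>} \<le> prob {\<omega>\<in>space M. X \<omega> \<bullet> \<beta> t < Y \<omega>}"
    using AE_Utilde_gt[OF t] by (intro finite_measure_mono_AE) auto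
  then show "prob {\<omega>\<in>space M. t < Utilde Y X \<beta> \<omega>} \<le> 1 - t" by (simp add: prob_exceed[OF t])
  show "1 - t \<le> prob {\<omega>\<in>space M. t < Utilde Y X \<beta> \<omega>}"
  proof (rule dense_le_bounded[of 0])
    show "0 < 1 - t" using t by simp
    \<comment> \<open>Here w = 1 - s is the exceedance probability at level s, so s > t means w < 1
      - t.\<close>
    fix w assume w: "0 < w" "w < 1 - t"
    then have s: "1 - w \<in> {0<..<1}" using t by auto
    have "w = prob {\<omega>\<in>space M. X \<omega> \<bullet> \<beta> (1 - w) < Y \<omega>}" using prob_exceed[OF s] by simp
    also have "\<dots> \<le> prob {\<omega>\<in>space M. t < Utilde Y X \<beta> \<omega>}"
      using AE_Utilde_ge[OF s] by (intro finite_measure_mono_AE) (use w in \<open>auto elim!: eventually_mono\<close>)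
    finally show "w \<le> prob {\<omega>\<in>space M. t < Utilde Y X \<beta> \<omega>}" .
  qed
qed

lemma Utilde_unif01: "unif01 M (Utilde Y X \<beta>)"
  by (rule unif01I) (auto simp: prob_Utilde_gt)

text \<open>One inclusion is known and both events have probability 1 - t.\<close>

lemma AE_Utilde_iff:
  assumes t: "t \<in> {0<..<1}"
  shows "AE \<omega> in M. t < Utilde Y X \<beta> \<omega> \<longleftrightarrow> X \<omega> \<bullet> \<beta> t < Y \<omega>"
  using t by (intro AE_iff_of_prob_eq AE_Utilde_gt) (auto simp: prob_exceed prob_Utilde_gt)

lemma Utilde_mean_indep: "mean_indep M X (Utilde Y X \<beta>)"
proof (rule mean_indepI[OF intX Utilde_unif01])
  fix t :: real assume t: "t \<in> {0<..<1}"
  have "(\<integral>\<omega>. (if t < Utilde Y X \<beta> \<omega> then X \<omega> else 0) \<partial>M) = score (\<beta> t)"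
    unfolding score_def using AE_Utilde_iff[OF t] by (intro integral_cong_AE) (auto elim!: eventually_mono)
  then show "(\<integral>\<omega>. (if t < Utilde Y X \<beta> \<omega> then X \<omega> else 0) \<partial>M) = (1 - t) *\<^sub>R (\<integral>\<omega>. X \<omega> \<partial>M)"
    by (simp add: score_beta[OF t])
qed

text \<open>On a single almost sure event, with u the value of \<open>Utilde\<close>, X.\<beta>(t)
  is at most Y for t < u and at least Y for t > u. Continuity of \<beta> at u lets both one-sided
  limits meet at Y.\<close>

lemma Utilde_represents: "AE \<omega> in M. Y \<omega> = X \<omega> \<bullet> \<beta> (Utilde Y X \<beta> \<omega>)"
  using AE_mono unif01_AE[OF Utilde_unif01]
proof eventually_elim
  case (elim \<omega>)
  define u where "u = Utilde Y X \<beta> \<omega>"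
  let ?g = "\<lambda>t. X \<omega> \<bullet> \<beta> t"
  have u: "u \<in> {0<..<1}" using elim by (simp add: u_def)
  have "continuous_on {0<..<1} ?g" by (intro continuous_intros beta_continuous)
  then have "isCont ?g u" using u by (simp add: continuous_on_eq_continuous_at)
  then have lim: "(?g \<longlongrightarrow> ?g u) (at_left u)" "(?g \<longlongrightarrow> ?g u) (at_right u)"
    unfolding isCont_def filterlim_at_split by auto
  have below: "?g t \<le> Y \<omega>" if "0 < t" "t < u" for t
    using level_measure_gt[OF elim(1), of t "Y \<omega>"] that u
    unfolding u_def Utilde_eq_measure by simp
  have above: "Y \<omega> \<le> ?g t" if "u < t" "t < 1" for t
  proof (rule ccontr)
    assume "\<not> Y \<omega> \<le> ?g t"
    then have "t \<le> u"
      using level_measure_ge[OF elim(1), of t "Y \<omega>"] that u unfolding u_def Utilde_eq_measure by simp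
    with that show False by simp
  qed
  have "?g u \<le> Y \<omega>"
    by (rule tendsto_upperbound[OF lim(1)])
       (use u below in \<open>auto simp: eventually_at_left_field intro!: exI[of _ 0]\<close>)
  moreover have "Y \<omega> \<le> ?g u"
    by (rule tendsto_lowerbound[OF lim(2)])
       (use u above in \<open>auto simp: eventually_at_right_field intro!: exI[of _ 1]\<close>)
  ultimately show ?case by (simp add: u_def)
qed

text \<open>Linear programming duality with \<beta>(t) as multiplier of the mean constraint at level
  t. For a feasible V the residual integrated over V > t is at most its mean positive part, with
  equality for \<open>Utilde\<close>. The layer-cake formula sums over t.\<close>

lemma Utilde_optimal:
  assumes V: "unif01 M V" and mi: "mean_indep M X V"
  shows "(\<integral>\<omega>. V \<omega> * Y \<omega> \<partial>M) \<le> (\<integral>\<omega>. Utilde Y X \<beta> \<omega> * Y \<omega> \<partial>M)"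
proof -
  note [measurable] = unif01_measurable[OF V]
  note lcV = layer_cake_unit_interval[OF unif01_measurable[OF V] unif01_AE[OF V] intY]
  note lcU = layer_cake_unit_interval[OF unif01_measurable[OF Utilde_unif01] unif01_AE[OF Utilde_unif01] intY]
  \<comment> \<open>The multiplier term depends on W only through the constraint, so it is the same
    for every feasible W and cancels in the comparison.\<close>
  have split: "(\<integral>\<omega>. (if t < W \<omega> then Y \<omega> else 0) \<partial>M) =
      (\<integral>\<omega>. (if t < W \<omega> then Y \<omega> - X \<omega> \<bullet> \<beta> t else 0) \<partial>M) + ((1 - t) *\<^sub>R (\<integral>\<omega>. X \<omega> \<partial>M)) \<bullet> \<beta> t"
    if t: "t \<in> {0<..<1}" and W: "unif01 M W" "mean_indep M X W" for t W
  proof -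
    note [measurable] = unif01_measurable[OF W(1)]
    have Xt: "integrable M (\<lambda>\<omega>. if t < W \<omega> then X \<omega> else 0)"
      by (rule Bochner_Integration.integrable_bound[OF intX]) auto
    have "integrable M (\<lambda>\<omega>. if t < W \<omega> then Y \<omega> - X \<omega> \<bullet> \<beta> t else 0)"
      by (rule Bochner_Integration.integrable_bound[OF integrable_residual[of "\<beta> t"]]) auto
    moreover have "(\<integral>\<omega>. (if t < W \<omega> then Y \<omega> else 0) \<partial>M) =
      (\<integral>\<omega>. (if t < W \<omega> then Y \<omega> - X \<omega> \<bullet> \<beta> t else 0) + (if t < W \<omega> then X \<omega> else 0) \<bullet> \<beta> t \<partial>M)"
      by (intro Bochner_Integration.integral_cong) auto
    ultimately show ?thesis
      using Xt mean_indep_tail[OF intX W t] by simp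
  qed
  have "(\<integral>\<omega>. (if t < V \<omega> then Y \<omega> else 0) \<partial>M) \<le> (\<integral>\<omega>. (if t < Utilde Y X \<beta> \<omega> then Y \<omega> else 0) \<partial>M)"
    if t: "t \<in> {0<..<1}" for t
  proof -
    have "(\<integral>\<omega>. (if t < V \<omega> then Y \<omega> - X \<omega> \<bullet> \<beta> t else 0) \<partial>M) \<le> (\<integral>\<omega>. max (Y \<omega> - X \<omega> \<bullet> \<beta> t) 0 \<partial>M)"
      by (rule integral_mono[OF _ integrable_pos_residual],
          rule Bochner_Integration.integrable_bound[OF integrable_residual[of "\<beta> t"]]) auto
    also have "\<dots> = (\<integral>\<omega>. (if t < Utilde Y X \<beta> \<omega> then Y \<omega> - X \<omega> \<bullet> \<beta> t else 0) \<partial>M)"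
      using AE_Utilde_iff[OF t] by (intro integral_cong_AE) (auto elim!: eventually_mono)
    finally show ?thesis
      unfolding split[OF t V mi] split[OF t Utilde_unif01 Utilde_mean_indep] by simp
  qed
  then show ?thesis
    unfolding lcV(2) lcU(2) by (intro integral_mono lcV(1) lcU(1)) (auto split: split_indicator)
qed

end

end

section \<open>Existence, optimality and uniqueness of the representation\<close>

theorem theorem3p3:
  fixes M :: "'a measure" and Y :: "'a \<Rightarrow> real" and X :: "'a \<Rightarrow> real^'p"
    and i1 :: 'p and \<beta> :: "real \<Rightarrow> real^'p" and f :: "real \<Rightarrow> real^'p \<Rightarrow> real"
  assumes P: "prob_space M"
    and Ymeas: "Y \<in> borel_measurable M" and Xmeas: "X \<in> borel_measurable M"
    and intercept: "\<forall>\<omega>\<in>space M. X \<omega> $ i1 = 1"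
    and beta: "\<forall>t\<in>{0<..<1}. is_qr_coef M Y X t (\<beta> t)"
    and intY: "integrable M Y"
    and intX2: "integrable M (\<lambda>\<omega>. (norm (X \<omega>))\<^sup>2)"
    and dens: "cond_density M Y X f"
    and bdd: "\<exists>C. \<forall>y x. \<bar>f y x\<bar> \<le> C"
    and ucont: "uniformly_continuous_on UNIV (\<lambda>(y, x). f y x)"
    and rank: "\<forall>t\<in>{0<..<1}. rank (jac_mat M X f (\<beta> t)) = CARD('p)"
  shows
   "((\<forall>x\<in>supp M X. strict_mono_on {0<..<1} (\<lambda>t. x \<bullet> \<beta> t)) \<longrightarrow>
       ((AE \<omega> in M. Y \<omega> = X \<omega> \<bullet> \<beta> (Utilde Y X \<beta> \<omega>))
        \<and> unif01 M (Utilde Y X \<beta>)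
        \<and> mean_indep M X (Utilde Y X \<beta>)
        \<and> (\<forall>V. unif01 M V \<and> mean_indep M X V \<longrightarrow>
               (\<integral>\<omega>. V \<omega> * Y \<omega> \<partial>M) \<le> (\<integral>\<omega>. Utilde Y X \<beta> \<omega> * Y \<omega> \<partial>M)))
       \<and> (\<forall>\<beta>b Ub. (AE \<omega> in M. Y \<omega> = \<beta>b (Ub \<omega>) \<bullet> X \<omega>) \<and> unif01 M Ub \<and> mean_indep M X Ub
              \<and> (AE \<omega> in M. strict_mono_on {0<..<1} (\<lambda>u. X \<omega> \<bullet> \<beta>b u)) \<longrightarrow>
              (AE \<omega> in M. Utilde Y X \<beta> \<omega> = Ub \<omega>)
              \<and> (AE \<omega> in M. X \<omega> \<bullet> \<beta> (Utilde Y X \<beta> \<omega>) = X \<omega> \<bullet> \<beta>b (Ub \<omega>))))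
    \<and> (\<forall>\<beta>0 U. (AE \<omega> in M. \<forall>u\<in>{0<..<1}. cond_quantile f u (X \<omega>) = X \<omega> \<bullet> \<beta>0 u)
              \<and> unif01 M U \<and> indep_rv M U X
              \<and> (AE \<omega> in M. Y \<omega> = X \<omega> \<bullet> \<beta>0 (U \<omega>)) \<longrightarrow>
              (AE \<omega> in M. U \<omega> = Utilde Y X \<beta> \<omega>) \<and> (AE \<omega> in M. \<beta>0 (U \<omega>) = \<beta> (U \<omega>)))"
proof -
  interpret prob_space M by (rule P)
  interpret linear_qr_process M Y X f \<beta>
    by unfold_locales (use assms in auto)
  have int: "\<And>\<omega>. \<omega> \<in> space M \<Longrightarrow> X \<omega> $ i1 = 1" using intercept by blast
  show ?thesis
  proof (intro conjI allI impI; (elim conjE)?)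
    assume "\<forall>x\<in>supp M X. strict_mono_on {0<..<1} (\<lambda>t. x \<bullet> \<beta> t)"
    then have mono: "\<And>x. x \<in> supp M X \<Longrightarrow> strict_mono_on {0<..<1} (\<lambda>t. x \<bullet> \<beta> t)" by blast
    show "AE \<omega> in M. Y \<omega> = X \<omega> \<bullet> \<beta> (Utilde Y X \<beta> \<omega>)" by (rule Utilde_represents[OF int mono])
    show "unif01 M (Utilde Y X \<beta>)" by (rule Utilde_unif01[OF int mono])
    show "mean_indep M X (Utilde Y X \<beta>)" by (rule Utilde_mean_indep[OF int mono])
    show "(\<integral>\<omega>. V \<omega> * Y \<omega> \<partial>M) \<le> (\<integral>\<omega>. Utilde Y X \<beta> \<omega> * Y \<omega> \<partial>M)"
      if "unif01 M V" "mean_indep M X V" for V by (rule Utilde_optimal[OF int mono that])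
  next
    fix \<beta>b Ub
    assume rep: "AE \<omega> in M. Y \<omega> = \<beta>b (Ub \<omega>) \<bullet> X \<omega>" and Ub: "unif01 M Ub" "mean_indep M X Ub"
      and mono: "AE \<omega> in M. strict_mono_on {0<..<1} (\<lambda>u. X \<omega> \<bullet> \<beta>b u)"
    have rep': "AE \<omega> in M. Y \<omega> = X \<omega> \<bullet> \<beta>b (Ub \<omega>)" using rep by (simp add: inner_commute)
    have u: "\<And>t. t \<in> {0<..<1} \<Longrightarrow> \<beta>b t = \<beta> t" "AE \<omega> in M. Utilde Y X \<beta> \<omega> = Ub \<omega>"
      using representation_unique[OF Ub(1) _ rep' mono] mean_indep_tail[OF intX Ub] by blast+
    show "AE \<omega> in M. Utilde Y X \<beta> \<omega> = Ub \<omega>" by (rule u(2))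
    show "AE \<omega> in M. X \<omega> \<bullet> \<beta> (Utilde Y X \<beta> \<omega>) = X \<omega> \<bullet> \<beta>b (Ub \<omega>)"
      using u(2) unif01_AE[OF Ub(1)] by eventually_elim (simp add: u(1))
  next
    fix \<beta>0 U
    assume q: "AE \<omega> in M. \<forall>u\<in>{0<..<1}. cond_quantile f u (X \<omega>) = X \<omega> \<bullet> \<beta>0 u"
      and U: "unif01 M U" "indep_rv M U X" and rep: "AE \<omega> in M. Y \<omega> = X \<omega> \<bullet> \<beta>0 (U \<omega>)"
    \<comment> \<open>Almost surely f(., X) has mass one, so its quantile function is strictly
      increasing; by linearity that function is X.\<beta>0(u), which supplies the monotonicity
      needed for uniqueness.\<close>
    have mono: "AE \<omega> in M. strict_mono_on {0<..<1} (\<lambda>u. X \<omega> \<bullet> \<beta>0 u)"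
      using q AE_density_integral
    proof eventually_elim
      case (elim \<omega>)
      have "strict_mono_on {0<..<1} (\<lambda>u. cond_quantile f u (X \<omega>))"
        using elim(2) by (intro cond_quantile_strict_mono f_nonneg) auto
      then show ?case using elim(1) by (simp add: strict_mono_on_def)
    qed
    have u: "\<And>t. t \<in> {0<..<1} \<Longrightarrow> \<beta>0 t = \<beta> t" "AE \<omega> in M. Utilde Y X \<beta> \<omega> = U \<omega>"
      using representation_unique[OF U(1) _ rep mono] indep_rv_tail[OF intX U] by blast+
    show "AE \<omega> in M. U \<omega> = Utilde Y X \<beta> \<omega>" using u(2) by eventually_elim simp
    show "AE \<omega> in M. \<beta>0 (U \<omega>) = \<beta> (U \<omega>)"
      using unif01_AE[OF U(1)] by eventually_elim (rule u(1))
  qed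
qed

end
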